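(* The Cesàro operator $\mathcal C: VH(\mathbb D)\to VH(\mathbb D)$ satisfies: (i) $\sigma_{pt}(\mathcal C;VH(\mathbb D))=\emptyset$; (ii) $\sigma(\mathcal C;VH(\mathbb D))=\{0\}\cup\{\lambda\in\mathbb C: \operatorname{Re}\lambda>0\}$.
   Context: $\mathbb D$ is the open unit disc and $H(\mathbb D)$ the space of analytic functions on $\mathbb D$ (compact-open topology). Define $v(z)=1$ if $|z|\le 1-1/e$ and $v(z)=(-\log(1-|z|))^{-1}$ if $1-1/e\le|z|<1$, $v_k=v^k$ ($k\in\mathbb N$), and $H^\infty_{v_k}=\{f\in H(\mathbb D):\sup_{z\in\mathbb D}v_k(z)|f(z)|<\infty\}$ with this sup as norm. $VH(\mathbb D)=\bigcup_k H^\infty_{v_k}$ with the inductive limit topology (finest locally convex topology making the inclusions continuous). The Cesàro operator is $\mathcal C f(z)=\frac1z\int_0^z\frac{f(\zeta)}{1-\zeta}\,d\zeta$ for $z\neq0$, $\mathcal Cf(0)=f(0)$; it is a continuous operator on $VH(\mathbb D)$. For a locally convex space $X$ and continuous linear $T:X\to X$, the resolvent set $\rho(T;X)$ is the set of $\lambda\in\mathbb C$ such that $\lambda I-T$ is bijective on $X$ with continuous inverse; $\sigma(T;X)=\mathbb C\setminus\rho(T;X)$ is the spectrum, and the point spectrum $\sigma_{pt}(T;X)$ is the set of $\lambda$ for which $\lambda I-T$ is not injective. *)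

theory Defs
  imports "HOL-Complex_Analysis.Complex_Analysis"
begin

definition Disc :: "complex set" where
  "Disc = ball 0 1"

definition vw :: "complex \<Rightarrow> real" where
  "vw z = (if norm z \<le> 1 - 1 / exp 1 then 1 else 1 / (- ln (1 - norm z)))"

text \<open>Elements of H(D) are represented by functions holomorphic on the disc and
  equal to 0 outside the disc (canonical representative).\<close>
definition HD :: "(complex \<Rightarrow> complex) set" where
  "HD = {f. f holomorphic_on Disc \<and> (\<forall>z. z \<notin> Disc \<longrightarrow> f z = 0)}"

definition Hv :: "nat \<Rightarrow> (complex \<Rightarrow> complex) set" where
  "Hv k = {f \<in> HD. \<exists>C. \<forall>z\<in>Disc. vw z ^ k * norm (f z) \<le> C}"

definition normv :: "nat \<Rightarrow> (complex \<Rightarrow> complex) \<Rightarrow> real" where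
  "normv k f = (SUP z\<in>Disc. vw z ^ k * norm (f z))"

definition VH :: "(complex \<Rightarrow> complex) set" where
  "VH = (\<Union>k\<in>{1..}. Hv k)"

text \<open>0-neighbourhoods of the locally convex inductive limit topology: absolutely
  convex subsets of VH whose trace on each step H^infty_{v_k} is a 0-neighbourhood
  of that Banach space.\<close>
definition VH_nhd0 :: "(complex \<Rightarrow> complex) set \<Rightarrow> bool" where
  "VH_nhd0 U \<longleftrightarrow> U \<subseteq> VH \<and>
     (\<forall>f\<in>U. \<forall>g\<in>U. \<forall>a b :: complex. norm a + norm b \<le> 1 \<longrightarrow> (\<lambda>z. a * f z + b * g z) \<in> U) \<and>
     (\<forall>k\<in>{1..}. \<exists>e>0. {f \<in> Hv k. normv k f < e} \<subseteq> U)"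

definition VH_open :: "(complex \<Rightarrow> complex) set \<Rightarrow> bool" where
  "VH_open S \<longleftrightarrow> S \<subseteq> VH \<and> (\<forall>f\<in>S. \<exists>U. VH_nhd0 U \<and> (\<lambda>g. (\<lambda>z. f z + g z)) ` U \<subseteq> S)"

lemma VH_nhd0_Int: "VH_nhd0 U \<Longrightarrow> VH_nhd0 W \<Longrightarrow> VH_nhd0 (U \<inter> W)"
proof -
  assume U: "VH_nhd0 U" and W: "VH_nhd0 W"
  note U' = U[unfolded VH_nhd0_def] and W' = W[unfolded VH_nhd0_def]
  have 3: "\<exists>e>0. {f \<in> Hv k. normv k f < e} \<subseteq> U \<inter> W" if "k \<in> {1..}" for k
  proof -
    have "\<exists>e>0. {f \<in> Hv k. normv k f < e} \<subseteq> U"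
      using U'[THEN conjunct2, THEN conjunct2] that by (rule bspec)
    then obtain e1 where e1: "e1 > 0" "{f \<in> Hv k. normv k f < e1} \<subseteq> U" by blast
    have "\<exists>e>0. {f \<in> Hv k. normv k f < e} \<subseteq> W"
      using W'[THEN conjunct2, THEN conjunct2] that by (rule bspec)
    then obtain e2 where e2: "e2 > 0" "{f \<in> Hv k. normv k f < e2} \<subseteq> W" by blast
    have "{f \<in> Hv k. normv k f < min e1 e2} \<subseteq> U \<inter> W"
      using e1(2) e2(2) by auto
    then show ?thesis using e1(1) e2(1) by (intro exI[of _ "min e1 e2"]) simp
  qed
  have 1: "U \<inter> W \<subseteq> VH" using U'[THEN conjunct1] by blast
  have 2: "\<forall>f\<in>U \<inter> W. \<forall>g\<in>U \<inter> W. \<forall>a b :: complex. norm a + norm b \<le> 1 \<longrightarrow> (\<lambda>z. a * f z + b * g z) \<in> U \<inter> W"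
  proof (intro ballI allI impI)
    fix f g and a b :: complex
    assume f: "f \<in> U \<inter> W" and g: "g \<in> U \<inter> W" and ab: "norm a + norm b \<le> 1"
    have "(\<lambda>z. a * f z + b * g z) \<in> U"
      using U'[THEN conjunct2, THEN conjunct1] f g ab by blast
    moreover have "(\<lambda>z. a * f z + b * g z) \<in> W"
      using W'[THEN conjunct2, THEN conjunct1] f g ab by blast
    ultimately show "(\<lambda>z. a * f z + b * g z) \<in> U \<inter> W" by blast
  qed
  show ?thesis unfolding VH_nhd0_def using 1 2 3 by blast
qed

lemma istopology_VH_open: "istopology VH_open"
  unfolding istopology_def
proof (intro conjI allI impI)
  fix S T assume S: "VH_open S" and T: "VH_open T"
  show "VH_open (S \<inter> T)"
    unfolding VH_open_def
  proof (intro conjI ballI)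
    show "S \<inter> T \<subseteq> VH" using S unfolding VH_open_def by blast
    fix f assume "f \<in> S \<inter> T"
    then obtain U W where "VH_nhd0 U" "(\<lambda>g. (\<lambda>z. f z + g z)) ` U \<subseteq> S"
      "VH_nhd0 W" "(\<lambda>g. (\<lambda>z. f z + g z)) ` W \<subseteq> T"
      using S T unfolding VH_open_def by blast
    then show "\<exists>U. VH_nhd0 U \<and> (\<lambda>g. (\<lambda>z. f z + g z)) ` U \<subseteq> S \<inter> T"
      using VH_nhd0_Int[of U W] by (intro exI[of _ "U \<inter> W"]) blast
  qed
next
  fix K assume K: "\<forall>S\<in>K. VH_open S"
  show "VH_open (\<Union>K)"
    unfolding VH_open_def
  proof (intro conjI ballI)
    show "\<Union>K \<subseteq> VH" using K unfolding VH_open_def by blast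
    fix f assume "f \<in> \<Union>K"
    then obtain S where "S \<in> K" "f \<in> S" by blast
    then obtain U where "VH_nhd0 U" "(\<lambda>g. (\<lambda>z. f z + g z)) ` U \<subseteq> S"
      using K unfolding VH_open_def by blast
    then show "\<exists>U. VH_nhd0 U \<and> (\<lambda>g. (\<lambda>z. f z + g z)) ` U \<subseteq> \<Union>K"
      using \<open>S \<in> K\<close> by blast
  qed
qed

definition VH_top :: "(complex \<Rightarrow> complex) topology" where
  "VH_top = topology VH_open"

lemma openin_VH_top: "openin VH_top S \<longleftrightarrow> VH_open S"
  unfolding VH_top_def using istopology_VH_open by (simp add: topology_inverse')

definition cesaro :: "(complex \<Rightarrow> complex) \<Rightarrow> (complex \<Rightarrow> complex)" where
  "cesaro f = (\<lambda>z. if z \<notin> Disc then 0 else if z = 0 then f 0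
       else (1 / z) * contour_integral (linepath 0 z) (\<lambda>\<zeta>. f \<zeta> / (1 - \<zeta>)))"

definition VH_resolvent :: "((complex \<Rightarrow> complex) \<Rightarrow> (complex \<Rightarrow> complex)) \<Rightarrow> complex set" where
  "VH_resolvent T = {l. let A = (\<lambda>f. (\<lambda>z. l * f z - T f z)) in
       bij_betw A VH VH \<and> continuous_map VH_top VH_top (inv_into VH A)}"

definition VH_spectrum :: "((complex \<Rightarrow> complex) \<Rightarrow> (complex \<Rightarrow> complex)) \<Rightarrow> complex set" where
  "VH_spectrum T = - VH_resolvent T"

definition VH_point_spectrum :: "((complex \<Rightarrow> complex) \<Rightarrow> (complex \<Rightarrow> complex)) \<Rightarrow> complex set" where
  "VH_point_spectrum T = {l. \<not> inj_on (\<lambda>f. (\<lambda>z. l * f z - T f z)) VH}"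

end

theory Submission
  imports Defs "HOL-Real_Asymp.Real_Asymp"
begin

text \<open>
  Put \<open>\<mu> = 1 / \<lambda>\<close>. Then \<open>h = C f\<close> turns \<open>f - \<mu> C f = g\<close> into the first order equation
  \<open>(1 - z) z h' = (\<mu> - 1 + z) h + g\<close>, whose homogeneous solutions are the multiples of
  \<open>z\<^sup>\<mu>\<^sup>-\<^sup>1 (1 - z)\<^sup>-\<^sup>\<mu>\<close>. Such a function is analytic at \<open>0\<close> only if \<open>\<mu> = 1, 2, \<dots>\<close>, and then it grows
  like a power of \<open>1 / (1 - \<bar>z\<bar>)\<close>, so it is not in \<open>VH\<close>: there are no eigenvalues.
  If \<open>Re \<mu> \<le> 0\<close>, the inhomogeneous equation has an analytic solution, which for \<open>g\<close> in the
  \<open>k\<close>-th step lies in the \<open>(k+1)\<close>-st step, with a norm bound; hence \<open>\<lambda>\<close> is in the resolvent set.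
  If \<open>Re \<mu> > 0\<close>, surjectivity fails: for \<open>\<mu> = m\<close> the monomial \<open>z\<^sup>m\<^sup>-\<^sup>1\<close> is not attained, by comparing
  coefficients; otherwise truncating the Taylor series of \<open>z\<^sup>\<mu>\<^sup>-\<^sup>1\<close> at \<open>1\<close> gives \<open>P(z) (1 - z)\<^sup>-\<^sup>\<mu>\<close>,
  outside \<open>VH\<close>, as the only analytic \<open>h\<close> for some bounded \<open>g\<close>.
  For \<open>\<lambda> = 0\<close>, the bounded function \<open>(1 + z)\<^sup>\<i>\<close> is the image only of a function that grows
  like \<open>1 / \<bar>1 + z\<bar>\<close> at \<open>-1\<close>.
\<close>

subsection \<open>Logarithmic growth and the inductive limit\<close>

text \<open>The reciprocal of the weight \<open>vw\<close> on the disc: \<open>1 - 1 / exp 1\<close>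
  is exactly the radius at which \<open>- ln (1 - norm z)\<close> reaches 1. Membership in the k-th
  step becomes a pointwise bound by a constant times the k-th power.\<close>

definition log_growth :: "complex \<Rightarrow> real" where
  "log_growth z = max 1 (- ln (1 - norm z))"

lemma log_growth_ge_1: "1 \<le> log_growth z"
  by (simp add: log_growth_def)

lemma log_growth_pos: "0 < log_growth z"
  using log_growth_ge_1[of z] by linarith

lemma log_growth_mono:
  assumes "norm w \<le> norm z" "norm z < 1"
  shows "log_growth w \<le> log_growth z"
proof -
  have "ln (1 - norm z) \<le> ln (1 - norm w)" using assms by simp
  then show ?thesis unfolding log_growth_def by linarith
qed

lemma vw_eq_inverse_log_growth:
  assumes "z \<in> Disc"
  shows "vw z = 1 / log_growth z"
proof -
  have z: "norm z < 1" using assms by (simp add: Disc_def)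
  have e: "(norm z \<le> 1 - 1 / exp 1) \<longleftrightarrow> - ln (1 - norm z) \<le> 1"
  proof -
    have "(norm z \<le> 1 - 1 / exp 1) \<longleftrightarrow> exp (-1) \<le> 1 - norm z"
      by (auto simp: exp_minus inverse_eq_divide)
    also have "\<dots> \<longleftrightarrow> -1 \<le> ln (1 - norm z)" using z by (simp add: ln_ge_iff)
    finally show ?thesis by linarith
  qed
  show ?thesis using e by (auto simp: vw_def log_growth_def max_def)
qed

lemma vw_power_mult_le_iff:
  assumes "z \<in> Disc"
  shows "vw z ^ k * norm (f z) \<le> C \<longleftrightarrow> norm (f z) \<le> C * log_growth z ^ k"
  using log_growth_pos[of z]
  by (simp add: vw_eq_inverse_log_growth[OF assms] power_one_over field_simps)

lemma Hv_iff:
  "f \<in> Hv k \<longleftrightarrow> f \<in> HD \<and> (\<exists>C. \<forall>z\<in>Disc. norm (f z) \<le> C * log_growth z ^ k)"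
  by (auto simp: Hv_def vw_power_mult_le_iff)

lemma norm_le_normv:
  assumes "f \<in> Hv k" "z \<in> Disc"
  shows "norm (f z) \<le> normv k f * log_growth z ^ k"
proof -
  obtain C where "\<forall>z\<in>Disc. vw z ^ k * norm (f z) \<le> C" using assms(1) by (auto simp: Hv_def)
  then have "bdd_above ((\<lambda>z. vw z ^ k * norm (f z)) ` Disc)" by (auto intro!: bdd_aboveI2)
  then have "vw z ^ k * norm (f z) \<le> normv k f"
    unfolding normv_def by (rule cSUP_upper[OF assms(2)])
  then show ?thesis by (simp add: vw_power_mult_le_iff[OF assms(2)])
qed

lemma normv_le:
  assumes "\<And>z. z \<in> Disc \<Longrightarrow> norm (f z) \<le> C * log_growth z ^ k"
  shows "normv k f \<le> C"
  unfolding normv_def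
proof (rule cSUP_least)
  show "Disc \<noteq> {}" by (simp add: Disc_def)
qed (simp add: vw_power_mult_le_iff assms)

lemma normv_nonneg:
  assumes "f \<in> Hv k" shows "0 \<le> normv k f"
proof -
  have "0 \<in> Disc" by (simp add: Disc_def)
  from norm_le_normv[OF assms this] have "0 \<le> normv k f * log_growth 0 ^ k"
    using norm_ge_zero order_trans by blast
  moreover have "0 < log_growth 0 ^ k" by (simp add: log_growth_pos)
  ultimately show ?thesis by (simp add: zero_le_mult_iff)
qed

lemma HD_lincomb: "f \<in> HD \<Longrightarrow> g \<in> HD \<Longrightarrow> (\<lambda>z. a * f z + b * g z) \<in> HD"
  by (auto simp: HD_def intro!: holomorphic_intros)

lemma Hv_mono:
  assumes "k \<le> m" shows "Hv k \<subseteq> Hv m"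
proof
  fix f assume f: "f \<in> Hv k"
  have "norm (f z) \<le> normv k f * log_growth z ^ m" if "z \<in> Disc" for z
    using norm_le_normv[OF f that] normv_nonneg[OF f]
      mult_left_mono[OF power_increasing[OF assms log_growth_ge_1[of z]], of "normv k f"]
    by linarith
  then show "f \<in> Hv m" using f by (auto simp: Hv_iff)
qed

lemma Hv_lincomb:
  assumes "f \<in> Hv k" "g \<in> Hv k"
  shows "(\<lambda>z. a * f z + b * g z) \<in> Hv k"
proof -
  have "norm (a * f z + b * g z) \<le> (norm a * normv k f + norm b * normv k g) * log_growth z ^ k"
    if "z \<in> Disc" for z
  proof -
    have "norm (a * f z + b * g z) \<le> norm a * norm (f z) + norm b * norm (g z)"
      by (metis norm_mult norm_triangle_ineq)
    also have "\<dots> \<le> norm a * (normv k f * log_growth z ^ k) + norm b * (normv k g * log_growth z ^ k)"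
      using norm_le_normv[OF _ that] assms by (intro add_mono mult_left_mono) auto
    finally show ?thesis by (simp add: algebra_simps)
  qed
  then show ?thesis using assms HD_lincomb by (auto simp: Hv_iff)
qed

lemma VH_lincomb:
  assumes "f \<in> VH" "g \<in> VH"
  shows "(\<lambda>z. a * f z + b * g z) \<in> VH"
proof -
  obtain k m where km: "1 \<le> k" "f \<in> Hv k" "1 \<le> m" "g \<in> Hv m" using assms by (auto simp: VH_def)
  then have "f \<in> Hv (max k m)" "g \<in> Hv (max k m)"
    using Hv_mono[of k "max k m"] Hv_mono[of m "max k m"] by auto
  from Hv_lincomb[OF this] km show ?thesis by (auto simp: VH_def intro!: bexI[of _ "max k m"])
qed

lemma VH_imp_HD: "f \<in> VH \<Longrightarrow> f \<in> HD"
  by (auto simp: VH_def Hv_def)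

lemma bounded_imp_VH:
  assumes "f \<in> HD" "\<And>z. z \<in> Disc \<Longrightarrow> norm (f z) \<le> B"
  shows "f \<in> VH"
proof -
  have "norm (f z) \<le> B * log_growth z ^ 1" if "z \<in> Disc" for z
  proof -
    have "0 \<le> B" using assms(2)[OF that] norm_ge_zero[of "f z"] by linarith
    then have "B * 1 \<le> B * log_growth z" using log_growth_ge_1 by (intro mult_left_mono)
    then show ?thesis using assms(2)[OF that] by simp
  qed
  then have "f \<in> Hv 1" using assms(1) unfolding Hv_iff by blast
  then show ?thesis by (auto simp: VH_def)
qed

lemma HD_restrict:
  "f holomorphic_on Disc \<Longrightarrow> (\<lambda>z. if z \<in> Disc then f z else 0) \<in> HD"
  by (auto simp: HD_def cong: holomorphic_cong)

text \<open>Every power of \<open>1 - x\<close> beats every power of its logarithm. This is the test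
  that excludes functions with a power singularity at a boundary point \<open>u\<close>.\<close>

lemma VH_radial_decay:
  assumes "f \<in> VH" "norm u = 1" "0 < a"
  shows "((\<lambda>x::real. (1 - x) powr a * norm (f (of_real x * u))) \<longlongrightarrow> 0) (at_left 1)"
proof -
  obtain k where k: "f \<in> Hv k" using assms(1) by (auto simp: VH_def)
  define C where "C = normv k f"
  have lim: "((\<lambda>x::real. C * ((1 - x) powr a * (- ln (1 - x)) ^ k)) \<longlongrightarrow> 0) (at_left 1)"
    using assms(3) by real_asymp
  \<comment> \<open>Beyond this radius the maximum in \<open>log_growth\<close> is the
    logarithm.\<close>
  have ev: "\<forall>\<^sub>F x::real in at_left 1. 1 - 1 / exp 1 < x \<and> x < 1"
    by (rule eventually_conj; real_asymp)
  show ?thesis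
  proof (rule Lim_null_comparison[OF _ lim])
    show "\<forall>\<^sub>F x in at_left 1. norm ((1 - x) powr a * norm (f (of_real x * u)))
            \<le> C * ((1 - x) powr a * (- ln (1 - x)) ^ k)"
      using ev
    proof eventually_elim
      case (elim x)
      have "1 / exp 1 < (1::real)" by simp
      then have x: "0 < x" "x < 1" using elim by linarith+
      have n: "norm (of_real x * u) = x" using x assms(2) by (simp add: norm_mult)
      then have z: "of_real x * u \<in> Disc" using x by (simp add: Disc_def)
      have "log_growth (of_real x * u) = - ln (1 - x)"
        using vw_eq_inverse_log_growth[OF z] elim n log_growth_pos[of "of_real x * u"]
        by (simp add: vw_def field_split_simps split: if_splits)
      then have "norm (f (of_real x * u)) \<le> C * (- ln (1 - x)) ^ k"
        using norm_le_normv[OF k z] by (simp add: C_def)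
      then have "(1 - x) powr a * norm (f (of_real x * u)) \<le> (1 - x) powr a * (C * (- ln (1 - x)) ^ k)"
        by (intro mult_left_mono) auto
      then show ?case by (simp add: ac_simps)
    qed
  qed
qed

section \<open>The inductive limit topology and continuity of linear maps\<close>

lemma VH_nhd0_VH: "VH_nhd0 VH"
  unfolding VH_nhd0_def
  by (auto intro: VH_lincomb) (auto simp: VH_def intro!: exI[of _ 1])

lemma topspace_VH_top: "topspace VH_top = VH"
proof
  show "topspace VH_top \<subseteq> VH"
    using openin_topspace[of VH_top] unfolding openin_VH_top VH_open_def by blast
  have "VH_open VH"
    unfolding VH_open_def using VH_nhd0_VH VH_lincomb[of _ _ 1 1] by fastforce
  then show "VH \<subseteq> topspace VH_top"
    using openin_subset openin_VH_top by blast
qed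

text \<open>A linear map that sends each step boundedly into some later or earlier step pulls
  absolutely convex 0-neighbourhoods back to such neighbourhoods; linearity moves this from 0 to
  every point.\<close>

lemma continuous_map_VH_top:
  assumes VH: "\<And>f. f \<in> VH \<Longrightarrow> T f \<in> VH"
    and lin: "\<And>f g a b. f \<in> VH \<Longrightarrow> g \<in> VH \<Longrightarrow>
      T (\<lambda>z. a * f z + b * g z) = (\<lambda>z. a * T f z + b * T g z)"
    and bound: "\<And>k. 1 \<le> k \<Longrightarrow> \<exists>m M. 1 \<le> m \<and> (\<forall>f\<in>Hv k. T f \<in> Hv m \<and> normv m (T f) \<le> M * normv k f)"
  shows "continuous_map VH_top VH_top T"
  unfolding continuous_map topspace_VH_top
proof (intro conjI allI impI)
  show "T ` VH \<subseteq> VH" using VH by blast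
next
  fix S assume "openin VH_top S"
  then have S: "VH_open S" by (simp add: openin_VH_top)
  show "openin VH_top {f \<in> VH. T f \<in> S}"
    unfolding openin_VH_top VH_open_def
  proof (intro conjI ballI)
    show "{f \<in> VH. T f \<in> S} \<subseteq> VH" by blast
    fix f assume f: "f \<in> {f \<in> VH. T f \<in> S}"
    then obtain U where U: "VH_nhd0 U" "(\<lambda>g. (\<lambda>z. T f z + g z)) ` U \<subseteq> S"
      using S unfolding VH_open_def by blast
    define W where "W = {u \<in> VH. T u \<in> U}"
    have "VH_nhd0 W"
      unfolding VH_nhd0_def
    proof (intro conjI ballI allI impI)
      show "W \<subseteq> VH" by (auto simp: W_def)
    next
      fix g h :: "complex \<Rightarrow> complex" and a b :: complex
      assume *: "g \<in> W" "h \<in> W" "norm a + norm b \<le> 1"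
      then have "(\<lambda>z. a * T g z + b * T h z) \<in> U"
        using U(1) unfolding VH_nhd0_def W_def by blast
      then show "(\<lambda>z. a * g z + b * h z) \<in> W"
        using * by (auto simp: W_def lin VH_lincomb)
    next
      fix k :: nat assume k: "k \<in> {1..}"
      then obtain m M where m: "1 \<le> m"
        and M: "\<And>f. f \<in> Hv k \<Longrightarrow> T f \<in> Hv m \<and> normv m (T f) \<le> M * normv k f"
        using bound[of k] by auto
      obtain e where e: "e > 0" "{f \<in> Hv m. normv m f < e} \<subseteq> U"
        using U(1) m unfolding VH_nhd0_def by (meson atLeast_iff)
      \<comment> \<open>\<open>M\<close> may be zero or negative; a positive bound is needed to
        divide \<open>e\<close> by it.\<close>
      define M' where "M' = max 1 M"
      have M': "0 < M'" "M \<le> M'" by (auto simp: M'_def)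
      have "u \<in> W" if u: "u \<in> Hv k" "normv k u < e / M'" for u
      proof -
        have "M * normv k u \<le> M' * normv k u"
          using normv_nonneg[OF u(1)] M' by (intro mult_right_mono)
        also have "\<dots> < e" using u(2) M' by (simp add: field_simps)
        finally have "normv m (T u) < e" using M[OF u(1)] by linarith
        then show ?thesis using e(2) M[OF u(1)] u k by (auto simp: W_def VH_def)
      qed
      then show "\<exists>e>0. {f \<in> Hv k. normv k f < e} \<subseteq> W"
        using e(1) M' by (intro exI[of _ "e / M'"]) auto
    qed
    moreover have "(\<lambda>z. f z + u z) \<in> {f \<in> VH. T f \<in> S}" if "u \<in> W" for u
    proof -
      have "T (\<lambda>z. f z + u z) = (\<lambda>z. T f z + T u z)"
        using lin[of f u 1 1] f that by (auto simp: W_def)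
      moreover have "(\<lambda>z. f z + u z) \<in> VH" using VH_lincomb[of f u 1 1] f that by (auto simp: W_def)
      ultimately show ?thesis using U(2) that by (auto simp: W_def)
    qed
    ultimately show "\<exists>U. VH_nhd0 U \<and> (\<lambda>g. (\<lambda>z. f z + g z)) ` U \<subseteq> {f \<in> VH. T f \<in> S}"
      by blast
  qed
qed

subsection \<open>The differential equation of the resolvent\<close>

text \<open>
  With \<open>\<mu> = 1 / \<lambda>\<close>, the equation \<open>f - \<mu> C f = g\<close> becomes this equation for
  \<open>h = C f\<close>; the case \<open>\<mu> = 0\<close>, \<open>g = f\<close> characterises \<open>C f\<close> itself.
\<close>
definition cesaro_ode :: "complex \<Rightarrow> (complex \<Rightarrow> complex) \<Rightarrow> (complex \<Rightarrow> complex) \<Rightarrow> bool" where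
  "cesaro_ode \<mu> g h \<longleftrightarrow> h holomorphic_on Disc \<and>
     (\<forall>z\<in>Disc. (1 - z) * z * deriv h z = (\<mu> - 1 + z) * h z + g z)"

lemma open_Disc: "open Disc" and connected_Disc: "connected Disc" and zero_in_Disc: "0 \<in> Disc"
  by (simp_all add: Disc_def)

lemma Disc_Re_pos: "z \<in> Disc \<Longrightarrow> 0 < Re (1 - z)"
  using complex_Re_le_cmod[of z] by (simp add: Disc_def)

lemma Disc_nonpos_Reals: "z \<in> Disc \<Longrightarrow> 1 - z \<notin> \<real>\<^sub>\<le>\<^sub>0"
  using Disc_Re_pos[of z] by (auto simp: complex_nonpos_Reals_iff)

lemma Disc_ne_1: "z \<in> Disc \<Longrightarrow> 1 - z \<noteq> 0"
  by (auto simp: Disc_def)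

lemma Disc_DERIV: "h holomorphic_on Disc \<Longrightarrow> z \<in> Disc \<Longrightarrow> (h has_field_derivative deriv h z) (at z)"
  using holomorphic_derivI open_Disc by blast

lemma Disc_scale: "z \<in> Disc \<Longrightarrow> 0 \<le> t \<Longrightarrow> t \<le> 1 \<Longrightarrow> of_real t * z \<in> Disc"
  using mult_left_le_one_le[of "norm z" t] by (auto simp: Disc_def norm_mult)

text \<open>
  The analytic solution is \<open>\<integral>\<^sub>0\<^sup>1 t\<^sup>-\<^sup>\<mu> q(tz) dt\<close>, whose kernel is discontinuous at \<open>0\<close> when
  \<open>Re \<mu> = 0\<close>; dividing the Taylor coefficients of \<open>q\<close> by \<open>n + 1 - \<mu>\<close> avoids the integral.
\<close>
lemma euler_ode_solution_exists:
  assumes q: "q holomorphic_on Disc" and \<mu>: "Re \<mu> \<le> 0"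
  obtains S where "S holomorphic_on Disc" "\<And>z. z \<in> Disc \<Longrightarrow> z * deriv S z + (1 - \<mu>) * S z = q z"
proof -
  define a where "a n = (deriv ^^ n) q 0 / fact n" for n
  define c where "c n = a n / (of_nat n + 1 - \<mu>)" for n
  \<comment> \<open>The real part of \<open>n + 1 - \<mu>\<close> is at least 1, so no division by
    zero occurs and the new coefficients are dominated by the old ones.\<close>
  have den: "1 \<le> norm (of_nat n + 1 - \<mu>)" for n
    using complex_Re_le_cmod[of "of_nat n + 1 - \<mu>"] \<mu> by simp
  then have den0: "of_nat n + 1 - \<mu> \<noteq> 0" for n
    by (metis norm_zero zero_less_one linorder_not_le)
  have a_sums: "(\<lambda>n. a n * z ^ n) sums q z" if "norm z < 1" for z
    using holomorphic_power_series[of q 0 1 z] q that by (simp add: Disc_def a_def)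
  have a_sum: "summable (\<lambda>n. norm (a n * z ^ n))" if z: "norm z < 1" for z
  proof -
    obtain r where r: "norm z < r" "r < 1" using dense[OF z] by blast
    have "summable (\<lambda>n. a n * of_real r ^ n)"
      using a_sums[of "of_real r"] r norm_ge_zero[of z] by (intro sums_summable) (auto simp: abs_less_iff)
    then show ?thesis using r norm_ge_zero[of z] by (intro powser_insidea) auto
  qed
  have c_sum: "summable (\<lambda>n. c n * z ^ n)" if "norm z < 1" for z
  proof (rule summable_comparison_test'[OF a_sum[OF that]])
    fix n
    have "norm (a n) / norm (of_nat n + 1 - \<mu>) \<le> norm (a n) / 1"
      using den[of n] den0[of n] by (intro divide_left_mono) auto
    then have "norm (c n) \<le> norm (a n)" by (simp add: c_def norm_divide)
    then show "norm (c n * z ^ n) \<le> norm (a n * z ^ n)"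
      unfolding norm_mult by (rule mult_right_mono) simp
  qed
  define S where "S z = (\<Sum>n. c n * z ^ n)" for z
  have c_sums: "(\<lambda>n. c n * z ^ n) sums S z" if "norm z < 1" for z
    using c_sum[OF that] by (simp add: S_def summable_sums)
  have hol: "S holomorphic_on Disc"
    unfolding Disc_def by (rule power_series_holomorphic[where a = c]) (use c_sums in auto)
  show thesis
  proof
    show "S holomorphic_on Disc" by (rule hol)
    fix z assume z: "z \<in> Disc"
    then have z': "norm z < 1" by (simp add: Disc_def)
    have "(\<lambda>n. diffs c n * z ^ n) sums deriv S z"
      by (rule termdiffs_sums_strong[OF c_sums Disc_DERIV[OF hol z] z'])
    then have "(\<lambda>n. z * (diffs c n * z ^ n)) sums (z * deriv S z)" by (rule sums_mult)
    then have "(\<lambda>n. (of_nat (Suc n) * c (Suc n)) * z ^ Suc n) sums (z * deriv S z)"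
      by (simp add: diffs_def ac_simps)
    \<comment> \<open>Shifting the index is free, because the term for \<open>n = 0\<close> is
      zero.\<close>
    then have "(\<lambda>n. of_nat n * c n * z ^ n) sums (z * deriv S z)"
      using sums_Suc_iff[of "\<lambda>n. of_nat n * c n * z ^ n"] by simp
    then have "(\<lambda>n. of_nat n * c n * z ^ n + (1 - \<mu>) * (c n * z ^ n)) sums (z * deriv S z + (1 - \<mu>) * S z)"
      by (intro sums_add sums_mult c_sums z')
    moreover have "of_nat n * c n * z ^ n + (1 - \<mu>) * (c n * z ^ n) = a n * z ^ n" for n
    proof -
      have "of_nat n * c n * z ^ n + (1 - \<mu>) * (c n * z ^ n) = (of_nat n + 1 - \<mu>) * c n * z ^ n"
        by (simp add: algebra_simps)
      also have "(of_nat n + 1 - \<mu>) * c n = a n" using den0 by (simp add: c_def)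
      finally show ?thesis .
    qed
    ultimately have "(\<lambda>n. a n * z ^ n) sums (z * deriv S z + (1 - \<mu>) * S z)" by simp
    then show "z * deriv S z + (1 - \<mu>) * S z = q z"
      using a_sums[OF z'] sums_unique2 by blast
  qed
qed

text \<open>\<open>exp (a * Ln (1 - z))\<close> is the principal branch of the a-th power of
  \<open>1 - z\<close>, analytic because \<open>1 - z\<close> stays in the right half-plane.\<close>

lemma DERIV_exp_Ln_1_minus:
  assumes "z \<in> Disc"
  shows "((\<lambda>z. exp (a * Ln (1 - z))) has_field_derivative - a / (1 - z) * exp (a * Ln (1 - z))) (at z)"
  using Disc_nonpos_Reals[OF assms] Disc_ne_1[OF assms]
  by (auto intro!: derivative_eq_intros simp: field_simps)

lemma holomorphic_exp_Ln_1_minus: "(\<lambda>z. exp (a * Ln (1 - z))) holomorphic_on Disc"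
  using DERIV_exp_Ln_1_minus open_Disc by (meson holomorphic_on_open)

text \<open>Splitting off the factor \<open>(1 - z)\<close> to the power \<open>- \<mu>\<close>
  removes the singularity at 1 and leaves an Euler equation whose only singular point is 0.\<close>

lemma cesaro_ode_solution_exists:
  assumes g: "g holomorphic_on Disc" and \<mu>: "Re \<mu> \<le> 0"
  obtains h where "cesaro_ode \<mu> g h"
proof -
  define q where "q z = exp ((\<mu> - 1) * Ln (1 - z)) * g z" for z
  have "q holomorphic_on Disc"
    unfolding q_def by (intro holomorphic_intros holomorphic_exp_Ln_1_minus g)
  from euler_ode_solution_exists[OF this \<mu>] obtain S where S: "S holomorphic_on Disc"
    "\<And>z. z \<in> Disc \<Longrightarrow> z * deriv S z + (1 - \<mu>) * S z = q z" by blast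
  define h where "h z = exp (- \<mu> * Ln (1 - z)) * S z" for z
  have hol: "h holomorphic_on Disc"
    unfolding h_def by (intro holomorphic_intros holomorphic_exp_Ln_1_minus S(1))
  have "(1 - z) * z * deriv h z = (\<mu> - 1 + z) * h z + g z" if z: "z \<in> Disc" for z
  proof -
    define E where "E = exp (- \<mu> * Ln (1 - z))"
    have "(h has_field_derivative (- (- \<mu>) / (1 - z) * E) * S z + deriv S z * E) (at z)"
      unfolding h_def E_def
      by (rule DERIV_mult[OF DERIV_exp_Ln_1_minus[OF z] Disc_DERIV[OF S(1) z]])
    then have "deriv h z = \<mu> / (1 - z) * E * S z + deriv S z * E"
      by (simp add: DERIV_imp_deriv)
    then have 1: "(1 - z) * z * deriv h z = \<mu> * z * h z + (1 - z) * E * (z * deriv S z)"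
    proof -
      have "w * z * (\<mu> / w * E * s + d * E) = \<mu> * z * (E * s) + w * E * (z * d)"
        if "w \<noteq> 0" for w s d using that by (simp add: field_simps)
      from this[OF Disc_ne_1[OF z]] show ?thesis
        unfolding \<open>deriv h z = _\<close> h_def E_def[symmetric] .
    qed
    have 2: "z * deriv S z = q z - (1 - \<mu>) * S z" using S(2)[OF z] by (simp add: algebra_simps)
    have "exp (- \<mu> * Ln (1 - z)) * exp ((\<mu> - 1) * Ln (1 - z)) * exp (Ln (1 - z)) = 1"
      unfolding exp_add[symmetric] by (simp add: algebra_simps)
    then have 3: "(1 - z) * E * q z = g z"
      using Disc_ne_1[OF z] by (simp add: E_def q_def ac_simps)
    have "(1 - z) * z * deriv h z = \<mu> * z * h z + (1 - z) * E * q z - (1 - z) * (1 - \<mu>) * h z"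
      unfolding 1 2 by (simp add: h_def E_def algebra_simps)
    then show ?thesis unfolding 3 by (simp add: algebra_simps)
  qed
  then show thesis using that hol by (auto simp: cesaro_ode_def)
qed

section \<open>Growth of analytic solutions\<close>

text \<open>Write \<open>1 - z = (1 - t z) - (1 - t) z\<close>; the second term has norm at most
  \<open>1 - t\<close>, which is at most the norm of \<open>1 - t z\<close>.\<close>

lemma norm_1_minus_ratio_le:
  assumes "z \<in> Disc" "0 \<le> t" "t \<le> 1"
  shows "norm (1 - z) \<le> 2 * norm (1 - of_real t * z)"
proof -
  have "(1 - of_real t * z) - of_real (1 - t) * z = 1 - z" by (simp add: algebra_simps)
  from norm_triangle_ineq4[of "1 - of_real t * z" "of_real (1 - t) * z", unfolded this]
  have "norm (1 - z) \<le> norm (1 - of_real t * z) + norm (of_real (1 - t) * z)" .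
  also have "norm (of_real (1 - t) * z) \<le> 1 - t"
    using assms by (auto simp: norm_mult Disc_def intro!: mult_left_le simp del: of_real_diff)
  also have "1 - t \<le> norm (1 - of_real t * z)"
  proof -
    have "norm (of_real t * z) \<le> t" using assms by (simp add: norm_mult Disc_def mult_left_le)
    then show ?thesis using norm_triangle_ineq2[of 1 "of_real t * z"] by simp
  qed
  finally show ?thesis by simp
qed

text \<open>Bounds the power \<open>\<mu>\<close> of \<open>(1 - t z) / (1 - z)\<close>. The first
  summand in the exponent comes from the ratio of moduli (using \<open>ln 2 \<le> 2\<close>), the
  second from two arguments differing by at most \<open>2 * pi\<close>.\<close>

lemma norm_exp_Ln_quotient_le:
  assumes "z \<in> Disc" "0 \<le> t" "t \<le> 1" "Re \<mu> \<le> 0"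
  shows "norm (exp (\<mu> * Ln (1 - of_real t * z) - \<mu> * Ln (1 - z))) \<le> exp (2 * norm \<mu> + 2 * pi * norm \<mu>)"
proof -
  let ?w = "1 - of_real t * z" and ?u = "1 - z"
  have w: "?w \<noteq> 0" and u: "?u \<noteq> 0" using assms Disc_scale Disc_ne_1 by blast+
  have "ln (norm ?u) \<le> ln (2 * norm ?w)"
    using norm_1_minus_ratio_le[OF assms(1-3)] u w by (subst ln_le_cancel_iff) auto
  also have "\<dots> = ln 2 + ln (norm ?w)" using w by (simp add: ln_mult)
  also have "ln (2::real) \<le> 2" using ln_le_minus_one[of "2::real"] by simp
  finally have 1: "ln (norm ?u) - ln (norm ?w) \<le> 2" by simp
  have R: "\<bar>Re \<mu>\<bar> \<le> norm \<mu>" and I: "\<bar>Im \<mu>\<bar> \<le> norm \<mu>"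
    by (rule abs_Re_le_cmod, rule abs_Im_le_cmod)
  have "Re (\<mu> * Ln ?w - \<mu> * Ln ?u)
        = - Re \<mu> * (ln (norm ?u) - ln (norm ?w)) + Im \<mu> * (Im (Ln ?u) - Im (Ln ?w))"
    using w u by (simp add: algebra_simps)
  also have "- Re \<mu> * (ln (norm ?u) - ln (norm ?w)) \<le> - Re \<mu> * 2"
    using 1 assms(4) by (intro mult_left_mono) auto
  also have "- Re \<mu> * 2 \<le> 2 * norm \<mu>" using R by linarith
  also have "Im \<mu> * (Im (Ln ?u) - Im (Ln ?w)) \<le> norm \<mu> * (2 * pi)"
  proof -
    have "\<bar>Im (Ln ?u) - Im (Ln ?w)\<bar> \<le> 2 * pi"
      using Im_Ln_le_pi[OF u] Im_Ln_le_pi[OF w] mpi_less_Im_Ln[OF u] mpi_less_Im_Ln[OF w] by linarith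
    then have "\<bar>Im \<mu> * (Im (Ln ?u) - Im (Ln ?w))\<bar> \<le> norm \<mu> * (2 * pi)"
      unfolding abs_mult using I by (intro mult_mono) auto
    then show ?thesis by linarith
  qed
  finally show ?thesis by (simp add: norm_exp_eq_Re algebra_simps)
qed

text \<open>The left side is the integral of \<open>1 / (1 - t r)\<close> over t from 0 to 1. For
  small \<open>r\<close> it is bounded by 2; for larger \<open>r\<close> dividing by
  \<open>r\<close> costs at most a factor 2.\<close>

lemma log_quotient_le:
  fixes r :: real
  assumes "0 < r" "r < 1"
  shows "- ln (1 - r) / r \<le> 2 * max 1 (- ln (1 - r))"
proof (cases "r \<le> 1 / 2")
  case True
  have "- ln (1 - r) = ln (1 / (1 - r))" using assms ln_div[of 1 "1 - r"] by simp
  also have "\<dots> \<le> 1 / (1 - r) - 1" using assms by (intro ln_le_minus_one) auto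
  also have "\<dots> = r / (1 - r)" using assms by (simp add: field_simps)
  also have "\<dots> \<le> 2 * r" using assms True by (simp add: field_simps)
  finally have "- ln (1 - r) / r \<le> 2" using assms by (simp add: field_simps)
  then show ?thesis by (smt (verit) max.cobounded1)
next
  case False
  have "ln (1 - r) \<le> 0" using assms by simp
  then have "- ln (1 - r) * 1 \<le> - ln (1 - r) * (2 * r)" using False by (intro mult_left_mono) auto
  then have "- ln (1 - r) / r \<le> 2 * (- ln (1 - r))" using assms by (simp add: field_simps)
  then show ?thesis by (smt (verit) max.cobounded2)
qed

text \<open>
  Along the ray through \<open>z\<close> the integrating factor \<open>E t = t\<^sup>1\<^sup>-\<^sup>\<mu> ((1 - tz) / (1 - z))\<^sup>\<mu>\<close> turns the
  equation into \<open>(E t h(tz))' = E t g(tz) / (t (1 - tz))\<close>. As \<open>Re \<mu> \<le> 0\<close> and \<open>\<bar>1 - z\<bar> \<le> 2 \<bar>1 - tz\<bar>\<close>,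
  \<open>\<bar>E t\<bar>\<close> is at most a constant times \<open>t\<close>, and the integral of \<open>1 / (1 - t \<bar>z\<bar>)\<close> costs one logarithm.
\<close>
lemma cesaro_ode_bound:
  assumes ode: "cesaro_ode \<mu> g h" and \<mu>: "Re \<mu> \<le> 0" and B: "0 \<le> B"
    and g: "\<And>w. w \<in> Disc \<Longrightarrow> norm (g w) \<le> B * log_growth w ^ k" and z: "z \<in> Disc"
  shows "norm (h z) \<le> 2 * exp (2 * norm \<mu> + 2 * pi * norm \<mu>) * B * log_growth z ^ Suc k"
proof (cases "z = 0")
  case True
  \<comment> \<open>At the origin the equation is algebraic and determines the value of
    \<open>h\<close>.\<close>
  have "(1 - \<mu>) * h 0 = g 0"
    using ode zero_in_Disc by (force simp: cesaro_ode_def algebra_simps)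
  then have "norm (1 - \<mu>) * norm (h 0) = norm (g 0)" by (metis norm_mult)
  moreover have "1 \<le> norm (1 - \<mu>)" using complex_Re_le_cmod[of "1 - \<mu>"] \<mu> by simp
  then have "1 * norm (h 0) \<le> norm (1 - \<mu>) * norm (h 0)" by (rule mult_right_mono) simp
  ultimately have "norm (h 0) \<le> norm (g 0)" by simp
  also have "\<dots> \<le> B" using g[OF zero_in_Disc] by (simp add: log_growth_def)
  also have "B \<le> (2 * exp (2 * norm \<mu> + 2 * pi * norm \<mu>)) * B"
  proof -
    have "1 \<le> exp (2 * norm \<mu> + 2 * pi * norm \<mu>)" by simp
    then have "1 \<le> 2 * exp (2 * norm \<mu> + 2 * pi * norm \<mu>)" by linarith
    then have "1 * B \<le> (2 * exp (2 * norm \<mu> + 2 * pi * norm \<mu>)) * B"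
      using B by (rule mult_right_mono)
    then show ?thesis by simp
  qed
  finally show ?thesis using True by (simp add: log_growth_def)
next
  case False
  define r where "r = norm z"
  have r: "0 < r" "r < 1" using False z by (auto simp: r_def Disc_def)
  define K where "K = exp (2 * norm \<mu> + 2 * pi * norm \<mu>)"
  define A where "A = K * (B * log_growth z ^ k)"
  have A0: "0 \<le> A" using B log_growth_pos[of z] by (simp add: A_def K_def)
  define E where "E w = exp ((1 - \<mu>) * Ln w + (\<mu> * Ln (1 - w * z) - \<mu> * Ln (1 - z)))" for w
  define \<phi> where "\<phi> t = E (of_real t) * h (of_real t * z)" for t :: real
  have hol: "h holomorphic_on Disc" using ode by (simp add: cesaro_ode_def)
  have E_bound: "norm (E (of_real t)) \<le> t * K" if t: "0 < t" "t \<le> 1" for t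
  proof -
    have "norm (E (of_real t)) = norm (exp ((1 - \<mu>) * Ln (of_real t))) *
            norm (exp (\<mu> * Ln (1 - of_real t * z) - \<mu> * Ln (1 - z)))"
      by (simp only: E_def exp_add norm_mult)
    also have "\<dots> \<le> t * K"
    proof (rule mult_mono)
      \<comment> \<open>For t at most 1, the power \<open>1 - Re \<mu>\<close> of t is at most t,
        since \<open>Re \<mu> \<le> 0\<close>. This t cancels the factor \<open>1 / t\<close> on the
        right of the equation.\<close>
      have "ln t \<le> 0" using t by simp
      then have "0 \<le> Re \<mu> * ln t" using \<mu> by (simp add: mult_nonpos_nonpos)
      then have "(1 - Re \<mu>) * ln t \<le> ln t" by (simp add: algebra_simps)
      then have "exp ((1 - Re \<mu>) * ln t) \<le> exp (ln t)" by simp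
      then show "norm (exp ((1 - \<mu>) * Ln (of_real t))) \<le> t"
        using t by (simp add: Ln_of_real norm_exp_eq_Re)
      show "norm (exp (\<mu> * Ln (1 - of_real t * z) - \<mu> * Ln (1 - z))) \<le> K"
        unfolding K_def using t \<mu> by (intro norm_exp_Ln_quotient_le z) auto
    qed (use t in auto)
    finally show ?thesis .
  qed
  have der: "(\<phi> has_vector_derivative E (of_real t) * (g (of_real t * z) / (of_real t * (1 - of_real t * z)))) (at t)"
    if t: "0 < t" "t \<le> 1" for t
  proof -
    define w where "w = complex_of_real t"
    have wz: "w * z \<in> Disc" using Disc_scale[OF z, of t] t by (simp add: w_def)
    have w0: "w \<noteq> 0" "w \<notin> \<real>\<^sub>\<le>\<^sub>0" using t by (auto simp: w_def)
    have n1: "1 - w * z \<noteq> 0" by (rule Disc_ne_1[OF wz])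
    have dE: "(E has_field_derivative E w * ((1 - \<mu>) / w - \<mu> * z / (1 - w * z))) (at w)"
      unfolding E_def using w0 Disc_nonpos_Reals[OF wz] n1
      by (auto intro!: derivative_eq_intros simp: field_simps)
    have dh: "((\<lambda>w. h (w * z)) has_field_derivative deriv h (w * z) * z) (at w)"
      by (rule DERIV_chain2[where g = "\<lambda>w. w * z", OF Disc_DERIV[OF hol wz]]) (auto intro!: derivative_eq_intros)
    have o: "(1 - w * z) * (w * z) * deriv h (w * z) = (\<mu> - 1 + w * z) * h (w * z) + g (w * z)"
      using ode wz by (simp add: cesaro_ode_def)
    have eq: "((1 - \<mu>) / w - \<mu> * z / (1 - w * z)) * h (w * z) + deriv h (w * z) * z
          = g (w * z) / (w * (1 - w * z))" (is "?L = ?R")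
    proof -
      have "(w * (1 - w * z)) * ?L = ((1 - \<mu>) * (1 - w * z) - \<mu> * z * w) * h (w * z)
              + (1 - w * z) * (w * z) * deriv h (w * z)"
      proof -
        have "(w * v) * (((1 - \<mu>) / w - \<mu> * z / v) * H + d * z) = ((1 - \<mu>) * v - \<mu> * z * w) * H + v * (w * z) * d"
          if "v \<noteq> 0" for v H d using that w0 by (simp add: field_simps)
        from this[OF n1] show ?thesis .
      qed
      also have "\<dots> = g (w * z)" unfolding o by (simp add: algebra_simps)
      finally show ?thesis using w0 n1 by (simp add: eq_divide_eq mult.commute)
    qed
    have E_distrib: "E w * X * H + D * E w = E w * (X * H + D)" for X H D by (simp add: algebra_simps)
    have "((\<lambda>w. E w * h (w * z)) has_field_derivative E w * (g (w * z) / (w * (1 - w * z)))) (at w)"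
      using DERIV_mult[OF dE dh] unfolding E_distrib eq .
    from has_vector_derivative_real_field[OF this[unfolded w_def]]
    show ?thesis unfolding \<phi>_def .
  qed
  \<comment> \<open>The integration starts at \<open>\<epsilon>\<close> because \<open>Ln\<close>
    and the quotient by t are singular at 0. In \<open>\<psi>\<close>, the majorant
    \<open>A / (1 - t r)\<close> is integrated.\<close>
  have le: "norm (h z) \<le> \<epsilon> * K * norm (h (of_real \<epsilon> * z)) + A * (- ln (1 - r) / r)"
    if e: "0 < \<epsilon>" "\<epsilon> < 1" for \<epsilon> :: real
  proof -
    define \<psi> where "\<psi> t = A * (- ln (1 - t * r) / r)" for t :: real
    have tr: "t * r < 1" if "t \<le> 1" for t
      using mult_right_mono[OF that, of r] r by linarith
    have d\<psi>: "(\<psi> has_real_derivative A / (1 - t * r)) (at t)" if "t \<le> 1" for t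
      unfolding \<psi>_def using tr[OF that] r by (auto intro!: derivative_eq_intros simp: field_simps)
    have "norm (\<phi> 1 - \<phi> \<epsilon>) \<le> \<psi> 1 - \<psi> \<epsilon>"
    proof (rule differentiable_bound_general[OF e(2)])
      show "continuous_on {\<epsilon>..1} \<phi>"
      proof (intro continuous_at_imp_continuous_on ballI)
        fix t assume "t \<in> {\<epsilon>..1}"
        then show "isCont \<phi> t" using e by (intro has_vector_derivative_continuous[OF der]) auto
      qed
      show "continuous_on {\<epsilon>..1} \<psi>"
        using d\<psi> e by (intro continuous_at_imp_continuous_on ballI) (auto intro: DERIV_isCont)
      fix t assume t: "\<epsilon> < t" "t < 1"
      show "(\<phi> has_vector_derivative E (of_real t) * (g (of_real t * z) / (of_real t * (1 - of_real t * z)))) (at t)"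
        using der t e by auto
      show "(\<psi> has_vector_derivative A / (1 - t * r)) (at t)"
        using d\<psi>[of t] t by (simp add: has_real_derivative_iff_has_vector_derivative)
      have wz: "of_real t * z \<in> Disc" using Disc_scale[OF z] t e by auto
      have "norm (of_real t * z) = t * r" using t e by (simp add: norm_mult r_def)
      then have n: "1 - t * r \<le> norm (1 - of_real t * z)"
        using norm_triangle_ineq2[of 1 "of_real t * z"] by simp
      have "norm (of_real t * z) \<le> norm z"
        using t e by (auto simp: norm_mult intro: mult_left_le_one_le)
      then have "log_growth (of_real t * z) \<le> log_growth z" using z by (intro log_growth_mono) (auto simp: Disc_def)
      then have "log_growth (of_real t * z) ^ k \<le> log_growth z ^ k"
        using log_growth_pos[of "of_real t * z"] by (intro power_mono) auto
      then have gb: "norm (g (of_real t * z)) \<le> B * log_growth z ^ k"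
        using g[OF wz] B mult_left_mono order_trans by blast
      have "norm (E (of_real t) * (g (of_real t * z) / (of_real t * (1 - of_real t * z))))
            = norm (E (of_real t)) * norm (g (of_real t * z)) / (t * norm (1 - of_real t * z))"
        using t e by (simp add: norm_mult norm_divide)
      also have "\<dots> \<le> (t * K) * (B * log_growth z ^ k) / (t * (1 - t * r))"
      proof (rule frac_le)
        show "0 < t * (1 - t * r)" using t e tr[of t] by simp
        show "t * (1 - t * r) \<le> t * norm (1 - of_real t * z)"
          using n t e by (intro mult_left_mono) auto
        show "norm (E (of_real t)) * norm (g (of_real t * z)) \<le> t * K * (B * log_growth z ^ k)"
          using E_bound[of t] gb t e by (intro mult_mono) (auto simp: K_def)
        show "0 \<le> t * K * (B * log_growth z ^ k)"
          using t e B log_growth_pos[of z] by (simp add: K_def)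
      qed
      also have "\<dots> = A / (1 - t * r)" using t e by (simp add: A_def)
      finally show "norm (E (of_real t) * (g (of_real t * z) / (of_real t * (1 - of_real t * z)))) \<le> A / (1 - t * r)" .
    qed
    moreover have "\<phi> 1 = h z" by (simp add: \<phi>_def E_def)
    moreover have "norm (\<phi> \<epsilon>) \<le> \<epsilon> * K * norm (h (of_real \<epsilon> * z))"
      unfolding \<phi>_def norm_mult using E_bound[of \<epsilon>] e by (intro mult_right_mono) auto
    moreover have "\<psi> 1 = A * (- ln (1 - r) / r)" by (simp add: \<psi>_def)
    moreover have "0 \<le> \<psi> \<epsilon>"
    proof -
      have "ln (1 - \<epsilon> * r) \<le> 0" using tr[of \<epsilon>] e r by simp
      then show ?thesis unfolding \<psi>_def using A0 r by (intro mult_nonneg_nonneg divide_nonneg_pos) auto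
    qed
    moreover have "norm (h z) \<le> norm (h z - \<phi> \<epsilon>) + norm (\<phi> \<epsilon>)"
      using norm_triangle_sub[of "h z" "\<phi> \<epsilon>"] by simp
    ultimately show ?thesis by simp
  qed
  \<comment> \<open>The boundary term disappears as \<open>\<epsilon>\<close> tends to 0,
    \<open>h\<close> being continuous at 0.\<close>
  have "((\<lambda>\<epsilon>. \<epsilon> * K * norm (h (of_real \<epsilon> * z)) + A * (- ln (1 - r) / r)) \<longlongrightarrow>
          0 * K * norm (h (of_real 0 * z)) + A * (- ln (1 - r) / r)) (at_right 0)"
  proof -
    have "isCont h (of_real 0 * z)"
      using Disc_DERIV[OF hol zero_in_Disc] DERIV_isCont by simp
    then have "((\<lambda>\<epsilon>::real. h (of_real \<epsilon> * z)) \<longlongrightarrow> h (of_real 0 * z)) (at_right 0)"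
      by (rule isCont_tendsto_compose) (intro tendsto_intros)
    then show ?thesis by (intro tendsto_intros)
  qed
  moreover have "\<forall>\<^sub>F \<epsilon> in at_right (0::real). norm (h z) \<le> \<epsilon> * K * norm (h (of_real \<epsilon> * z)) + A * (- ln (1 - r) / r)"
    using eventually_at_right_real[OF zero_less_one] by eventually_elim (rule le; simp)
  ultimately have "norm (h z) \<le> 0 * K * norm (h (of_real 0 * z)) + A * (- ln (1 - r) / r)"
    by (rule tendsto_lowerbound) simp
  also have "\<dots> \<le> A * (2 * log_growth z)"
    using mult_left_mono[OF log_quotient_le[OF r] A0] by (simp add: log_growth_def r_def)
  finally show ?thesis by (simp add: A_def K_def ac_simps)
qed

section \<open>The Cesaro operator as solution operator of the equation\<close>

lemma cesaro_ode_cong: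
  assumes "cesaro_ode \<mu> g h" "\<And>z. z \<in> Disc \<Longrightarrow> g z = g' z" "\<And>z. z \<in> Disc \<Longrightarrow> h z = h' z"
  shows "cesaro_ode \<mu> g' h'"
proof -
  have "h' holomorphic_on Disc"
    using assms(1,3) holomorphic_transform unfolding cesaro_ode_def by blast
  moreover have "deriv h z = deriv h' z" if "z \<in> Disc" for z
    using assms(3) that open_Disc by (intro deriv_cong_ev refl) (auto simp: eventually_nhds)
  ultimately show ?thesis using assms unfolding cesaro_ode_def by metis
qed

lemma cesaro_ode_lincomb:
  assumes "cesaro_ode \<mu> g h" "cesaro_ode \<mu> g' h'"
  shows "cesaro_ode \<mu> (\<lambda>z. a * g z + b * g' z) (\<lambda>z. a * h z + b * h' z)"
proof -
  have hol: "h holomorphic_on Disc" "h' holomorphic_on Disc" using assms by (auto simp: cesaro_ode_def)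
  have "(1 - z) * z * deriv (\<lambda>z. a * h z + b * h' z) z
      = (\<mu> - 1 + z) * (a * h z + b * h' z) + (a * g z + b * g' z)" if z: "z \<in> Disc" for z
  proof -
    have "deriv (\<lambda>z. a * h z + b * h' z) z = a * deriv h z + b * deriv h' z"
      by (intro DERIV_imp_deriv DERIV_add DERIV_cmult Disc_DERIV hol z)
    then have "(1 - z) * z * deriv (\<lambda>z. a * h z + b * h' z) z
        = a * ((1 - z) * z * deriv h z) + b * ((1 - z) * z * deriv h' z)" by (simp add: algebra_simps)
    also have "\<dots> = a * ((\<mu> - 1 + z) * h z + g z) + b * ((\<mu> - 1 + z) * h' z + g' z)"
      using assms z by (simp add: cesaro_ode_def)
    finally show ?thesis by (simp add: algebra_simps)
  qed
  then show ?thesis using hol by (auto simp: cesaro_ode_def intro!: holomorphic_intros)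
qed

lemma cesaro_ode_shift:
  assumes "\<And>z. z \<in> Disc \<Longrightarrow> f z = \<mu> * h z + g z"
  shows "cesaro_ode 0 f h \<longleftrightarrow> cesaro_ode \<mu> g h"
  unfolding cesaro_ode_def using assms by (auto simp: algebra_simps)

text \<open>For \<open>\<mu> = 0\<close> the equation says that \<open>w * h w\<close> is a
  primitive of \<open>f w / (1 - w)\<close>, vanishing at 0; at the origin it reduces to
  \<open>h 0 = f 0\<close>.\<close>

lemma cesaro_eq_of_ode:
  assumes ode: "cesaro_ode 0 f h" and z: "z \<in> Disc"
  shows "cesaro f z = h z"
proof (cases "z = 0")
  case True
  then show ?thesis using ode zero_in_Disc by (auto simp: cesaro_ode_def cesaro_def)
next
  case False
  have hol: "h holomorphic_on Disc" using ode by (simp add: cesaro_ode_def)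
  have der: "((\<lambda>w. w * h w) has_field_derivative f w / (1 - w)) (at w within Disc)" if w: "w \<in> Disc" for w
  proof -
    have "(1 - w) * w * deriv h w = (w - 1) * h w + f w"
      using ode w by (simp add: cesaro_ode_def)
    then have "(1 - w) * (1 * h w + deriv h w * w) = f w" by algebra
    then have "1 * h w + deriv h w * w = f w / (1 - w)"
      using nonzero_mult_div_cancel_left[OF Disc_ne_1[OF w]] by metis
    then have "((\<lambda>w. w * h w) has_field_derivative f w / (1 - w)) (at w)"
      using DERIV_mult[OF DERIV_ident Disc_DERIV[OF hol w]] by simp
    then show ?thesis by (rule has_field_derivative_at_within)
  qed
  have "closed_segment 0 z \<subseteq> Disc"
    using zero_in_Disc z by (intro closed_segment_subset) (auto simp: Disc_def)
  with contour_integral_primitive[OF der, of "linepath 0 z"]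
  have "contour_integral (linepath 0 z) (\<lambda>w. f w / (1 - w)) = z * h z"
    by (intro contour_integral_unique) auto
  then show ?thesis using False z by (simp add: cesaro_def)
qed

text \<open>An analytic solution exists and must coincide with \<open>cesaro f\<close>; this also
  yields analyticity at 0, where the integral formula is singular.\<close>

lemma cesaro_ode_cesaro:
  assumes "f \<in> HD"
  shows "cesaro_ode 0 f (cesaro f)"
proof -
  have "f holomorphic_on Disc" using assms by (simp add: HD_def)
  then obtain h where "cesaro_ode 0 f h" using cesaro_ode_solution_exists[of f 0] by auto
  then show ?thesis using cesaro_eq_of_ode by (metis cesaro_ode_cong)
qed

lemma cesaro_HD: "f \<in> HD \<Longrightarrow> cesaro f \<in> HD"
  using cesaro_ode_cesaro[of f] by (auto simp: HD_def cesaro_ode_def cesaro_def)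

text \<open>The case \<open>\<mu> = 0\<close> of the growth bound: one extra logarithm.\<close>

lemma cesaro_Hv:
  assumes "f \<in> Hv k" shows "cesaro f \<in> Hv (Suc k)"
proof -
  have "f \<in> HD" using assms by (simp add: Hv_def)
  with cesaro_ode_bound[OF cesaro_ode_cesaro[OF this] _ normv_nonneg[OF assms] norm_le_normv[OF assms]]
  show ?thesis using cesaro_HD by (auto simp: Hv_iff)
qed

lemma cesaro_VH: "f \<in> VH \<Longrightarrow> cesaro f \<in> VH"
  using cesaro_Hv by (force simp: VH_def)

lemma cesaro_lincomb:
  assumes "f \<in> HD" "g \<in> HD"
  shows "cesaro (\<lambda>z. a * f z + b * g z) = (\<lambda>z. a * cesaro f z + b * cesaro g z)"
proof
  fix z
  show "cesaro (\<lambda>z. a * f z + b * g z) z = a * cesaro f z + b * cesaro g z"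
  proof (cases "z \<in> Disc")
    case True
    then show ?thesis
      by (intro cesaro_eq_of_ode[OF cesaro_ode_lincomb] cesaro_ode_cesaro assms)
  qed (simp add: cesaro_def)
qed

lemma cesaro_ode_of_resolvent_eq:
  assumes "f \<in> HD" "l \<noteq> 0" "\<And>z. z \<in> Disc \<Longrightarrow> l * f z - cesaro f z = g z"
  shows "cesaro_ode (1 / l) (\<lambda>z. g z / l) (cesaro f)"
proof -
  have "f z = (1 / l) * cesaro f z + g z / l" if "z \<in> Disc" for z
    using assms(2) assms(3)[OF that, symmetric] by (simp add: field_simps)
  from cesaro_ode_shift[OF this] show ?thesis using cesaro_ode_cesaro[OF assms(1)] by simp
qed

section \<open>Comparison of lowest coefficients at 0\<close>

lemma isCont_eq_of_eq_punctured:
  fixes F G :: "complex \<Rightarrow> complex"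
  assumes "isCont F a" "isCont G a" "0 < r" "\<And>z. z \<in> ball a r \<Longrightarrow> z \<noteq> a \<Longrightarrow> F z = G z"
  shows "F a = G a"
proof -
  have "\<forall>\<^sub>F z in at a. F z = G z"
    unfolding eventually_at using assms(3,4) by (auto intro!: exI[of _ r] simp: dist_commute)
  moreover have "(F \<longlongrightarrow> F a) (at a)" "(G \<longlongrightarrow> G a) (at a)"
    using assms(1,2) by (auto simp: isCont_def)
  ultimately show ?thesis using tendsto_cong tendsto_unique trivial_limit_at by metis
qed

text \<open>Here \<open>n\<close> is the order of vanishing of \<open>h\<close> at 0 and
  \<open>c\<close> its leading coefficient. Subtraction is truncated: the right side is
  \<open>a\<close> for \<open>n = j\<close>, zero for \<open>n < j\<close>, and zero for
  \<open>n > j\<close> because then \<open>a = 0\<close>.\<close>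

lemma cesaro_ode_order_at_0:
  assumes ode: "cesaro_ode \<mu> (\<lambda>z. a * z ^ j) h" and nz: "z0 \<in> Disc" "h z0 \<noteq> 0"
  obtains n c where "c \<noteq> 0" "(of_nat n + 1 - \<mu>) * c = a * 0 ^ (j - n)" "j < n \<Longrightarrow> a = 0"
proof -
  have hol: "h holomorphic_on Disc" using ode by (simp add: cesaro_ode_def)
  obtain n k r where r: "0 < r" "ball 0 r \<subseteq> Disc" and k: "k holomorphic_on ball 0 r" "k 0 \<noteq> 0"
    and h: "\<And>w. w \<in> ball 0 r \<Longrightarrow> h w = w ^ n * k w"
  proof (cases "h 0 = 0")
    case True
    have "\<not> h constant_on Disc"
      using True nz zero_in_Disc unfolding constant_on_def by metis
    from holomorphic_factor_zero_nonconstant[OF hol open_Disc connected_Disc zero_in_Disc True this]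
    obtain g r n where "0 < r" "ball 0 r \<subseteq> Disc" "g holomorphic_on ball 0 r"
      "\<And>w. w \<in> ball 0 r \<Longrightarrow> h w = (w - 0) ^ n * g w" "\<And>w. w \<in> ball 0 r \<Longrightarrow> g w \<noteq> 0" by metis
    then show ?thesis by (intro that[of r g n]) auto
  next
    case False
    then show ?thesis using hol by (intro that[of 1 h 0]) (auto simp: Disc_def)
  qed
  have dk: "(k has_field_derivative deriv k w) (at w)" if "w \<in> ball 0 r" for w
    using k(1) that holomorphic_derivI open_ball by blast
  have eq: "(1 - w) * (of_nat n * w ^ n * k w + w ^ n * w * deriv k w)
      = (\<mu> - 1 + w) * (w ^ n * k w) + a * w ^ j" if w: "w \<in> ball 0 r" for w
  proof -
    have "((\<lambda>w. w ^ n * k w) has_field_derivative of_nat n * w ^ (n - 1) * k w + deriv k w * w ^ n) (at w)"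
      by (rule derivative_eq_intros dk[OF w] refl)+ simp
    moreover have "deriv h w = deriv (\<lambda>w. w ^ n * k w) w"
      using h w by (intro deriv_cong_ev refl) (auto simp: eventually_nhds intro!: exI[of _ "ball 0 r"])
    ultimately have "deriv h w = of_nat n * w ^ (n - 1) * k w + deriv k w * w ^ n"
      by (simp add: DERIV_imp_deriv)
    then have "w * deriv h w = (of_nat n * (w * w ^ (n - 1))) * k w + w ^ n * w * deriv k w"
      by (simp add: algebra_simps)
    also have "of_nat n * (w * w ^ (n - 1)) = of_nat n * w ^ n" by (cases n) auto
    finally have "(1 - w) * w * deriv h w = (1 - w) * (of_nat n * w ^ n * k w + w ^ n * w * deriv k w)"
      by (simp add: mult.assoc)
    moreover have "(1 - w) * w * deriv h w = (\<mu> - 1 + w) * h w + a * w ^ j"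
      using ode w r by (auto simp: cesaro_ode_def)
    ultimately show ?thesis using h[OF w] by simp
  qed
  have 0: "0 \<in> ball 0 r" using r by simp
  have ck: "isCont k 0" using dk[OF 0] DERIV_isCont by blast
  have "deriv k holomorphic_on ball 0 r" using k(1) by (intro holomorphic_deriv) auto
  then have cdk: "isCont (deriv k) 0"
    using 0 open_ball holomorphic_on_imp_continuous_on continuous_on_eq_continuous_at by blast
  \<comment> \<open>Divided by \<open>w ^ j\<close>, every term except \<open>a\<close> keeps a
    positive power of w and vanishes at 0.\<close>
  have a0: "a = 0" if nj: "j < n"
  proof -
    have "(\<lambda>w. w ^ (n - j) * ((1 - w) * (of_nat n * k w + w * deriv k w) - (\<mu> - 1 + w) * k w)) 0 = (\<lambda>w. a) 0"
    proof (rule isCont_eq_of_eq_punctured[where r = r and F = "\<lambda>w. w ^ (n - j) * ((1 - w) * (of_nat n * k w + w * deriv k w) - (\<mu> - 1 + w) * k w)" and G = "\<lambda>w. a"])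
      show "0 < r" by (rule r(1))
    next
      fix w :: complex assume w: "w \<in> ball 0 r" "w \<noteq> 0"
      have "w ^ j * (w ^ (n - j) * ((1 - w) * (of_nat n * k w + w * deriv k w) - (\<mu> - 1 + w) * k w))
          = w ^ n * ((1 - w) * (of_nat n * k w + w * deriv k w) - (\<mu> - 1 + w) * k w)"
        using power_add[of w j "n - j"] nj by (simp add: mult.assoc)
      also have "\<dots> = w ^ j * a" using eq[OF w(1)] by (simp add: algebra_simps)
      finally show "w ^ (n - j) * ((1 - w) * (of_nat n * k w + w * deriv k w) - (\<mu> - 1 + w) * k w) = a"
        using w(2) by simp
    qed (intro continuous_intros ck cdk)+
    then show "a = 0" using nj by (auto simp: power_0_left)
  qed
  \<comment> \<open>Cancelling \<open>w ^ n\<close> and evaluating at 0 leaves the relation for the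
    leading coefficient \<open>k 0\<close>.\<close>
  have "(\<lambda>w. (1 - w) * (of_nat n * k w + w * deriv k w)) 0 = (\<lambda>w. (\<mu> - 1 + w) * k w + a * w ^ (j - n)) 0"
  proof (rule isCont_eq_of_eq_punctured[where r = r and F = "\<lambda>w. (1 - w) * (of_nat n * k w + w * deriv k w)" and G = "\<lambda>w. (\<mu> - 1 + w) * k w + a * w ^ (j - n)"])
    show "0 < r" by (rule r(1))
  next
    fix w :: complex assume w: "w \<in> ball 0 r" "w \<noteq> 0"
    have "a * w ^ j = a * (w ^ n * w ^ (j - n))"
      using a0 power_add[of w n "j - n"] by (cases "j < n") auto
    then have "w ^ n * ((1 - w) * (of_nat n * k w + w * deriv k w)) = w ^ n * ((\<mu> - 1 + w) * k w + a * w ^ (j - n))"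
      using eq[OF w(1)] by (simp add: algebra_simps)
    then show "(1 - w) * (of_nat n * k w + w * deriv k w) = (\<mu> - 1 + w) * k w + a * w ^ (j - n)"
      using w(2) by simp
  qed (intro continuous_intros ck cdk)+
  then have "(of_nat n + 1 - \<mu>) * k 0 = a * 0 ^ (j - n)" by (simp add: algebra_simps)
  then show thesis using that k(2) a0 by blast
qed

subsection \<open>Injectivity and failure of surjectivity\<close>

lemma cesaro_ode_homogeneous_nonzero:
  assumes ode: "cesaro_ode \<mu> (\<lambda>z. 0) h" and nz: "z0 \<in> Disc" "h z0 \<noteq> 0"
  obtains n where "\<mu> = of_nat (Suc n)"
proof -
  have "cesaro_ode \<mu> (\<lambda>z. 0 * z ^ 0) h" using ode by simp
  from cesaro_ode_order_at_0[OF this nz] obtain n and c :: complex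
    where "c \<noteq> 0" "(of_nat n + 1 - \<mu>) * c = 0" by (metis mult_zero_left)
  then have "of_nat n + 1 - \<mu> = 0" by simp
  then have "\<mu> = of_nat (Suc n)" by (simp add: algebra_simps)
  then show thesis by (rule that)
qed

text \<open>A nonzero solution forces \<open>\<mu> = n + 1\<close> and is then a multiple of
  \<open>z ^ n / (1 - z) ^ (n + 1)\<close>, whose pole at 1 is incompatible with logarithmic
  growth.\<close>

lemma cesaro_ode_homogeneous_VH:
  assumes ode: "cesaro_ode \<mu> (\<lambda>z. 0) h" and VH: "h \<in> VH" and z0: "z0 \<in> Disc"
  shows "h z0 = 0"
proof (rule ccontr)
  assume nz: "h z0 \<noteq> 0"
  obtain n where n: "\<mu> = of_nat (Suc n)" using cesaro_ode_homogeneous_nonzero[OF ode z0 nz] .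
  have hol: "h holomorphic_on Disc" using ode by (simp add: cesaro_ode_def)
  \<comment> \<open>The quotient of \<open>h\<close> by the explicit solution; its derivative
    vanishes on the connected punctured disc.\<close>
  define Q where "Q z = h z * (1 - z) ^ Suc n / z ^ n" for z
  have con: "connected (Disc - {0})" unfolding Disc_def by (rule connected_punctured_ball) simp
  have op: "open (Disc - {0})" using open_Disc by (simp add: open_delete)
  have dQ: "(Q has_field_derivative 0) (at z)" if z: "z \<in> Disc - {0}" for z
  proof -
    have z': "z \<in> Disc" "z \<noteq> 0" using z by auto
    have o: "(1 - z) * z * deriv h z = (of_nat n + z) * h z"
      using ode z' by (simp add: cesaro_ode_def n)
    have "(Q has_field_derivative ((deriv h z * (1 - z) ^ Suc n + h z * (of_nat (Suc n) * (1 - z) ^ n * (-1))) * z ^ n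
          - h z * (1 - z) ^ Suc n * (of_nat n * z ^ (n - 1))) / (z ^ n * z ^ n)) (at z)"
      unfolding Q_def
      by (rule derivative_eq_intros Disc_DERIV[OF hol z'(1)] refl | use z' in simp)+
    moreover have "(deriv h z * (1 - z) ^ Suc n + h z * (of_nat (Suc n) * (1 - z) ^ n * (-1))) * z ^ n
          - h z * (1 - z) ^ Suc n * (of_nat n * z ^ (n - 1)) = 0" (is "?X = 0")
    proof -
      have zn: "z * (of_nat n * z ^ (n - 1)) = of_nat n * z ^ n" by (cases n) auto
      have "z * ?X = (1 - z) ^ n * z ^ n * ((1 - z) * z * deriv h z - of_nat (Suc n) * z * h z)
               - h z * (1 - z) ^ Suc n * (z * (of_nat n * z ^ (n - 1)))"
        by (simp add: algebra_simps)
      also have "\<dots> = 0" unfolding zn o by (simp add: algebra_simps)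
      finally show ?thesis using z' by simp
    qed
    ultimately show ?thesis by simp
  qed
  have "\<exists>c. \<forall>z\<in>Disc - {0}. Q z = c"
    using DERIV_zero_connected_constant[OF con op finite.emptyI, of Q] dQ
    by (metis DERIV_isCont Diff_empty continuous_at_imp_continuous_on)
  then obtain c where c: "\<And>z. z \<in> Disc - {0} \<Longrightarrow> Q z = c" by blast
  \<comment> \<open>Along the positive radius this expression is constantly \<open>norm c\<close>,
    while decay in \<open>VH\<close> sends it to 0.\<close>
  have "((\<lambda>x::real. (1 - x) powr real (Suc n) * norm (h (of_real x * 1)) / x ^ n) \<longlongrightarrow> 0 / 1 ^ n) (at_left 1)"
    using VH_radial_decay[OF VH, of 1 "real (Suc n)"] by (intro tendsto_intros) auto
  moreover have "\<forall>\<^sub>F x::real in at_left 1. (1 - x) powr real (Suc n) * norm (h (of_real x * 1)) / x ^ n = norm c"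
    using eventually_at_left_real[OF zero_less_one]
  proof eventually_elim
    case (elim x)
    then have x: "of_real x \<in> Disc - {0}" by (auto simp: Disc_def)
    have "norm (1 - complex_of_real x) = 1 - x"
      using elim by (metis abs_of_nonneg diff_ge_0_iff_ge greaterThanLessThan_iff less_imp_le norm_of_real of_real_1 of_real_diff)
    then have "norm c = norm (h (of_real x)) * (1 - x) ^ Suc n / x ^ n"
      using c[OF x, symmetric] elim by (simp add: Q_def norm_mult norm_divide norm_power)
    also have "(1 - x) ^ Suc n = (1 - x) powr real (Suc n)"
      using elim by (subst powr_realpow) auto
    finally show ?case by (simp add: mult.commute)
  qed
  ultimately have "((\<lambda>x::real. norm c) \<longlongrightarrow> 0 / 1 ^ n) (at_left 1)"
    by (rule Lim_transform_eventually)
  then have "c = 0" by (simp add: tendsto_const_iff)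
  then have h0: "h z = 0" if "z \<in> Disc" "z \<noteq> 0" for z
    using c[of z] that Disc_ne_1[OF that(1)] by (auto simp: Q_def)
  have "h 0 = 0"
  proof (rule isCont_eq_of_eq_punctured[where F = h and G = "\<lambda>_. 0" and r = 1])
    show "isCont h 0" using Disc_DERIV[OF hol zero_in_Disc] DERIV_isCont by blast
  qed (auto intro: h0 simp: Disc_def)
  then show False using nz h0 z0 by (cases "z0 = 0") auto
qed

text \<open>For \<open>l \<noteq> 0\<close> the image under \<open>cesaro\<close> of a kernel
  element solves the homogeneous equation. For \<open>l = 0\<close> the equation with
  \<open>\<mu> = 0\<close> recovers the function from its zero image.\<close>

lemma inj_on_resolvent_operator: "inj_on (\<lambda>f z. l * f z - cesaro f z) VH"
proof (rule inj_onI)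
  fix f g assume f: "f \<in> VH" and g: "g \<in> VH"
    and eq: "(\<lambda>z. l * f z - cesaro f z) = (\<lambda>z. l * g z - cesaro g z)"
  define d where "d z = 1 * f z + (-1) * g z" for z
  have dVH: "d \<in> VH" unfolding d_def using f g by (rule VH_lincomb)
  have Cd: "cesaro d z = cesaro f z - cesaro g z" for z
    unfolding d_def using cesaro_lincomb[OF VH_imp_HD[OF f] VH_imp_HD[OF g], of 1 "-1"] by simp
  have ld: "l * d z - cesaro d z = 0" for z
    using fun_cong[OF eq, of z] by (simp add: Cd d_def algebra_simps)
  have "d z = 0" if z: "z \<in> Disc" for z
  proof (cases "l = 0")
    case True
    have C0: "cesaro d w = 0" for w using ld[of w] True by simp
    then have "cesaro d = (\<lambda>_. 0)" by blast
    then have "deriv (cesaro d) z = 0"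
      by simp
    then show ?thesis
      using cesaro_ode_cesaro[OF VH_imp_HD[OF dVH]] z C0 by (auto simp: cesaro_ode_def)
  next
    case False
    have "cesaro_ode (1 / l) (\<lambda>z. 0 / l) (cesaro d)"
      using ld by (intro cesaro_ode_of_resolvent_eq[OF VH_imp_HD[OF dVH] False])
    then have "cesaro d z = 0"
      using cesaro_ode_homogeneous_VH[OF _ cesaro_VH[OF dVH] z] by simp
    then show ?thesis using ld[of z] False by simp
  qed
  moreover have "d z = 0" if "z \<notin> Disc" for z
    using VH_imp_HD[OF dVH] that by (simp add: HD_def)
  ultimately show "f = g" by (auto simp: fun_eq_iff d_def)
qed

section \<open>Targets outside the range\<close>

text \<open>Both \<open>norm (1 - z)\<close> and the argument are bounded, so powers with
  nonnegative real part of the exponent are bounded. This puts the targets chosen below in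
  \<open>VH\<close>.\<close>

lemma norm_exp_Ln_le:
  assumes "z \<in> Disc" "0 \<le> Re a"
  shows "norm (exp (a * Ln (1 - z))) \<le> exp (2 * norm a + pi * norm a)"
proof -
  have n: "1 - z \<noteq> 0" by (rule Disc_ne_1[OF assms(1)])
  have "ln (norm (1 - z)) \<le> norm (1 - z) - 1" using n by (intro ln_le_minus_one) auto
  also have "\<dots> \<le> 2" using norm_triangle_ineq4[of 1 z] assms(1) by (simp add: Disc_def)
  finally have "Re a * ln (norm (1 - z)) \<le> Re a * 2" using assms(2) by (rule mult_left_mono)
  also have "\<dots> \<le> norm a * 2" using complex_Re_le_cmod[of a] by simp
  finally have 1: "Re a * ln (norm (1 - z)) \<le> 2 * norm a" by simp
  have "\<bar>Im a * Im (Ln (1 - z))\<bar> \<le> norm a * pi"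
    unfolding abs_mult using Im_Ln_le_pi[OF n] mpi_less_Im_Ln[OF n] abs_Im_le_cmod[of a]
    by (intro mult_mono) auto
  then show ?thesis using 1 n by (simp add: norm_exp_eq_Re algebra_simps)
qed

text \<open>
  \<open>P\<close> is the Taylor polynomial at \<open>1\<close> of \<open>z\<^sup>\<mu>\<^sup>-\<^sup>1\<close>, the first factor of the formal eigenfunction
  \<open>z\<^sup>\<mu>\<^sup>-\<^sup>1 (1 - z)\<^sup>-\<^sup>\<mu>\<close>.
\<close>
lemma truncated_eigenfunction_exists:
  "\<exists>P P' \<gamma>. P 1 = 1 \<and> (\<forall>z. (P has_field_derivative P' z) (at z)) \<and>
     (\<forall>z::complex. z * P' z - (\<mu> - 1) * P z = \<gamma> * (1 - z) ^ N)"
proof (induction N)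
  case 0
  show ?case
    by (rule exI[of _ "\<lambda>z. 1"], rule exI[of _ "\<lambda>z. 0"], rule exI[of _ "1 - \<mu>"])
       (auto simp: algebra_simps)
next
  case (Suc N)
  then obtain P P' \<gamma> where P: "P 1 = 1" "\<And>z. (P has_field_derivative P' z) (at z)"
    "\<And>z. z * P' z - (\<mu> - 1) * P z = \<gamma> * (1 - z) ^ N" by blast
  \<comment> \<open>Through its derivative the new term contributes
    \<open>- \<gamma> * z * (1 - z) ^ N\<close>, which raises the remainder by one power of
    \<open>1 - z\<close>; the value at 1 is unchanged.\<close>
  define b where "b = \<gamma> / of_nat (Suc N)"
  have b: "of_nat (Suc N) * b = \<gamma>" unfolding b_def by (simp del: of_nat_Suc)
  define R where "R z = P z + b * (1 - z) ^ Suc N" for z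
  define R' where "R' z = P' z - \<gamma> * (1 - z) ^ N" for z
  have "(R has_field_derivative R' z) (at z)" for z
  proof -
    have "(R has_field_derivative P' z + b * (of_nat (Suc N) * (1 - z) ^ N * (-1))) (at z)"
      unfolding R_def by (rule derivative_eq_intros P(2) refl | simp)+
    then show ?thesis by (simp add: R'_def b[symmetric] algebra_simps)
  qed
  moreover have "z * R' z - (\<mu> - 1) * R z = (\<gamma> - (\<mu> - 1) * b) * (1 - z) ^ Suc N" for z
  proof -
    have "z * R' z - (\<mu> - 1) * R z
        = (z * P' z - (\<mu> - 1) * P z) - \<gamma> * z * (1 - z) ^ N - (\<mu> - 1) * b * (1 - z) ^ Suc N"
      by (simp add: R_def R'_def algebra_simps)
    also have "\<dots> = \<gamma> * (1 - z) * (1 - z) ^ N - (\<mu> - 1) * b * (1 - z) ^ Suc N"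
      unfolding P(3) by (simp add: algebra_simps)
    finally show ?thesis by (simp add: algebra_simps)
  qed
  moreover have "R 1 = 1" by (simp add: R_def P)
  ultimately show ?case by blast
qed

lemma not_surj_resolvent_operator_pos:
  assumes l: "0 < Re l"
  shows "(\<lambda>f z. l * f z - cesaro f z) ` VH \<noteq> VH"
proof
  assume surj: "(\<lambda>f z. l * f z - cesaro f z) ` VH = VH"
  define \<mu> where "\<mu> = 1 / l"
  have l0: "l \<noteq> 0" using l by auto
  have \<mu>: "0 < Re \<mu>" unfolding \<mu>_def using l by (simp add: Re_divide add_nonneg_pos field_simps power2_eq_square sum_power2_gt_zero_iff)
  \<comment> \<open>Surjectivity in terms of the equation: every bounded analytic right side has a
    solution that is the image of an element of \<open>VH\<close>.\<close>
  have sol: "\<exists>f\<in>VH. cesaro_ode \<mu> g (cesaro f)"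
    if g: "g holomorphic_on Disc" "\<And>z. z \<in> Disc \<Longrightarrow> norm (g z) \<le> B" for g B
  proof -
    define G where "G z = (if z \<in> Disc then l * g z else 0)" for z
    have "G \<in> VH"
    proof (rule bounded_imp_VH)
      show "G \<in> HD" unfolding G_def using g(1) by (intro HD_restrict holomorphic_intros)
      show "norm (G z) \<le> norm l * B" if "z \<in> Disc" for z
        using that g(2)[OF that] by (simp add: G_def norm_mult mult_left_mono)
    qed
    then obtain f where f: "f \<in> VH" "G = (\<lambda>z. l * f z - cesaro f z)" using surj by blast
    then have "cesaro_ode \<mu> (\<lambda>z. G z / l) (cesaro f)"
      unfolding \<mu>_def by (intro cesaro_ode_of_resolvent_eq VH_imp_HD l0) auto
    then have "cesaro_ode \<mu> g (cesaro f)" by (rule cesaro_ode_cong) (simp_all add: G_def l0)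
    then show ?thesis using f by blast
  qed
  show False
  proof (cases "\<exists>n. \<mu> = of_nat (Suc n)")
    case True
    then obtain j where j: "\<mu> = of_nat (Suc j)" by blast
    have "norm (z ^ j) \<le> 1" if "z \<in> Disc" for z
      using that by (simp add: Disc_def norm_power power_le_one)
    then obtain f where f: "cesaro_ode \<mu> (\<lambda>z. z ^ j) (cesaro f)"
      using sol[of "\<lambda>z. z ^ j" 1] holomorphic_on_power[OF holomorphic_on_ident] by blast
    then have f1: "cesaro_ode \<mu> (\<lambda>z. 1 * z ^ j) (cesaro f)" by simp
    have "\<exists>z\<in>Disc. cesaro f z \<noteq> 0"
    proof (rule ccontr)
      assume "\<not> (\<exists>z\<in>Disc. cesaro f z \<noteq> 0)"
      then have "cesaro_ode \<mu> (\<lambda>z. z ^ j) (\<lambda>z. 0)"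
        by (intro cesaro_ode_cong[OF f]) auto
      moreover have "1 / 2 \<in> Disc" by (simp add: Disc_def)
      ultimately show False by (auto simp: cesaro_ode_def)
    qed
    then obtain z0 where z0: "z0 \<in> Disc" "cesaro f z0 \<noteq> 0" by blast
    obtain n c where nc: "c \<noteq> 0" "(of_nat n + 1 - \<mu>) * c = 1 * 0 ^ (j - n)" "j < n \<Longrightarrow> (1::complex) = 0"
      using cesaro_ode_order_at_0[OF f1 z0] by metis
    \<comment> \<open>Order below \<open>j\<close> would give \<open>\<mu> = n + 1\<close>, order
      \<open>j\<close> gives \<open>0 = 1\<close>, and order above \<open>j\<close> makes the
      coefficient 1 vanish.\<close>
    consider "n < j" | "n = j" | "j < n" by linarith
    then show False
    proof cases
      case 1
      then have "(of_nat n + 1 - \<mu>) * c = 0" using nc(2) by simp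
      then have "of_nat n + 1 - \<mu> = 0" using nc(1) by (metis mult_eq_0_iff)
      then show False using 1 by (simp add: j)
    qed (use nc j in auto)
  next
    case False
    \<comment> \<open>With this \<open>N\<close> the exponent in \<open>g\<close> has positive real
      part, so \<open>g\<close> is bounded although \<open>h\<close> is not in
      \<open>VH\<close>.\<close>
    obtain N where N: "Re \<mu> \<le> real N" using real_arch_simple by blast
    obtain P P' \<gamma> where P: "P 1 = 1" "\<And>z. (P has_field_derivative P' z) (at z)"
      "\<And>z. z * P' z - (\<mu> - 1) * P z = \<gamma> * (1 - z) ^ N"
      using truncated_eigenfunction_exists[of \<mu> N] by blast
    define h where "h z = P z * exp (- \<mu> * Ln (1 - z))" for z
    define g where "g z = \<gamma> * exp ((of_nat N + 1 - \<mu>) * Ln (1 - z))" for z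
    have holP: "P holomorphic_on Disc" using P(2) by (meson holomorphic_on_open open_Disc)
    have holg: "g holomorphic_on Disc" unfolding g_def by (intro holomorphic_intros holomorphic_exp_Ln_1_minus)
    have ode: "cesaro_ode \<mu> g h"
      unfolding cesaro_ode_def
    proof (intro conjI ballI)
      show "h holomorphic_on Disc" unfolding h_def by (intro holomorphic_intros holP holomorphic_exp_Ln_1_minus)
      fix z assume z: "z \<in> Disc"
      define E where "E = exp (- \<mu> * Ln (1 - z))"
      have "(h has_field_derivative P' z * E + (- (- \<mu>) / (1 - z) * E) * P z) (at z)"
        unfolding h_def E_def by (rule DERIV_mult[OF P(2) DERIV_exp_Ln_1_minus[OF z]])
      then have d: "deriv h z = P' z * E + \<mu> / (1 - z) * E * P z"
        by (simp add: DERIV_imp_deriv)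
      have "w * z * (p' * E + \<mu> / w * E * p) = w * E * (z * p') + \<mu> * z * p * E" if "w \<noteq> 0" for w p p'
        using that by (simp add: field_simps)
      from this[OF Disc_ne_1[OF z]]
      have "(1 - z) * z * deriv h z = (1 - z) * E * (z * P' z) + \<mu> * z * P z * E" unfolding d .
      also have "z * P' z = (\<mu> - 1) * P z + \<gamma> * (1 - z) ^ N" using P(3)[of z] by (simp add: algebra_simps)
      finally have "(1 - z) * z * deriv h z = (\<mu> - 1 + z) * (P z * E) + \<gamma> * ((1 - z) ^ N * (1 - z) * E)"
        by (simp add: algebra_simps)
      also have "(1 - z) ^ N * (1 - z) * E = exp ((of_nat N + 1 - \<mu>) * Ln (1 - z))"
      proof -
        have "(of_nat N + 1 - \<mu>) * Ln (1 - z) = of_nat N * Ln (1 - z) + Ln (1 - z) + - \<mu> * Ln (1 - z)"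
          by (simp add: algebra_simps)
        then show ?thesis
          by (simp only: exp_add exp_of_nat_mult exp_Ln[OF Disc_ne_1[OF z]] E_def)
      qed
      finally show "(1 - z) * z * deriv h z = (\<mu> - 1 + z) * h z + g z"
        by (simp only: h_def[of z] g_def E_def)
    qed
    have "norm (g z) \<le> norm \<gamma> * exp (2 * norm (of_nat N + 1 - \<mu>) + pi * norm (of_nat N + 1 - \<mu>))"
      if "z \<in> Disc" for z
      unfolding g_def norm_mult using N by (intro mult_left_mono norm_exp_Ln_le that) auto
    from sol[OF holg this] obtain f where f: "f \<in> VH" "cesaro_ode \<mu> g (cesaro f)" by blast
    have "cesaro_ode \<mu> (\<lambda>z. 1 * g z + (-1) * g z) (\<lambda>z. 1 * h z + (-1) * cesaro f z)"
      by (rule cesaro_ode_lincomb[OF ode f(2)])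
    then have hom: "cesaro_ode \<mu> (\<lambda>z. 0) (\<lambda>z. h z - cesaro f z)" by simp
    \<comment> \<open>As \<open>\<mu>\<close> is not a positive integer, the homogeneous equation
      has only the zero solution.\<close>
    have hC: "h z = cesaro f z" if "z \<in> Disc" for z
      using cesaro_ode_homogeneous_nonzero[OF hom that] False by force
    have "((\<lambda>x::real. (1 - x) powr Re \<mu> * norm (cesaro f (of_real x * 1))) \<longlongrightarrow> 0) (at_left 1)"
      by (rule VH_radial_decay[OF cesaro_VH[OF f(1)] _ \<mu>]) simp
    \<comment> \<open>On the real radius \<open>Ln (1 - x)\<close> is real, so only
      \<open>Re \<mu>\<close> affects the norm. What remains tends to \<open>norm (P 1) = 1\<close>,
      not to 0.\<close>
    moreover have "\<forall>\<^sub>F x::real in at_left 1. (1 - x) powr Re \<mu> * norm (cesaro f (of_real x * 1)) = norm (P (of_real x))"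
      using eventually_at_left_real[OF zero_less_one]
    proof eventually_elim
      case (elim x)
      then have x: "of_real x \<in> Disc" by (auto simp: Disc_def)
      have "Ln (1 - of_real x) = of_real (ln (1 - x))"
        using elim Ln_of_real[of "1 - x"] by simp
      then have "norm (h (of_real x)) = norm (P (of_real x)) * exp (- Re \<mu> * ln (1 - x))"
        by (simp add: h_def norm_mult norm_exp_eq_Re)
      moreover have "(1 - x) powr Re \<mu> * exp (- Re \<mu> * ln (1 - x)) = 1"
        using elim by (simp add: powr_def flip: exp_add)
      ultimately show ?case using hC[OF x] by simp
    qed
    ultimately have "((\<lambda>x::real. norm (P (of_real x))) \<longlongrightarrow> 0) (at_left 1)"
      by (rule Lim_transform_eventually)
    moreover have "((\<lambda>x::real. norm (P (of_real x))) \<longlongrightarrow> norm (P (of_real 1))) (at_left 1)"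
      by (intro tendsto_norm isCont_tendsto_compose[OF DERIV_isCont[OF P(2)]]
          tendsto_of_real tendsto_ident_at)
    ultimately have "0 = norm (P (of_real 1))" by (rule tendsto_unique[OF trivial_limit_at_left_real])
    then show False using P(1) by simp
  qed
qed

lemma not_surj_cesaro: "(\<lambda>f z. 0 * f z - cesaro f z) ` VH \<noteq> VH"
proof
  assume surj: "(\<lambda>f z. 0 * f z - cesaro f z) ` VH = VH"
  \<comment> \<open>The imaginary exponent keeps the function bounded while it oscillates at -1,
    where its derivative has size \<open>1 / norm (1 + z)\<close>.\<close>
  define e where "e z = exp (\<i> * Ln (1 - (- z)))" for z
  have mDisc: "- z \<in> Disc" if "z \<in> Disc" for z using that by (simp add: Disc_def)
  have de: "(e has_field_derivative \<i> / (1 + z) * e z) (at z)" if z: "z \<in> Disc" for z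
  proof -
    have "(e has_field_derivative - \<i> / (1 - (- z)) * exp (\<i> * Ln (1 - (- z))) * (- 1)) (at z)"
      unfolding e_def
      by (rule DERIV_chain2[where g = uminus, OF DERIV_exp_Ln_1_minus[OF mDisc[OF z]]])
         (auto intro!: derivative_eq_intros)
    then show ?thesis by (simp add: e_def)
  qed
  \<comment> \<open>The minus sign matches the operator at \<open>l = 0\<close>, which is
    \<open>- cesaro\<close>.\<close>
  define G where "G z = (if z \<in> Disc then - e z else 0)" for z
  have "G \<in> VH"
  proof (rule bounded_imp_VH)
    have "e holomorphic_on Disc" using de by (meson holomorphic_on_open open_Disc)
    then show "G \<in> HD" unfolding G_def by (intro HD_restrict holomorphic_intros)
    show "norm (G z) \<le> exp (2 * norm \<i> + pi * norm \<i>)" if "z \<in> Disc" for z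
      using norm_exp_Ln_le[OF mDisc[OF that], of \<i>] that by (simp add: G_def e_def)
  qed
  then obtain f where f: "f \<in> VH" "G = (\<lambda>z. 0 * f z - cesaro f z)" using surj by blast
  have C: "e z = cesaro f z" if "z \<in> Disc" for z
    using fun_cong[OF f(2), of z] that by (simp add: G_def)
  have ode: "cesaro_ode 0 f e"
    using cesaro_ode_cong[OF cesaro_ode_cesaro[OF VH_imp_HD[OF f(1)]]] C by simp
  have "((\<lambda>x::real. (1 - x) powr 1 * norm (f (of_real x * (- 1)))) \<longlongrightarrow> 0) (at_left 1)"
    using f(1) by (intro VH_radial_decay) auto
  moreover have "\<forall>\<^sub>F x::real in at_left 1. x \<le> (1 - x) powr 1 * norm (f (of_real x * (- 1)))"
    using eventually_at_left_real[OF zero_less_one]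
  proof eventually_elim
    case (elim x)
    define z where "z = - complex_of_real x"
    have z: "z \<in> Disc" using elim by (simp add: Disc_def z_def)
    have z1: "1 + z \<noteq> 0" using Disc_ne_1[OF mDisc[OF z]] by simp
    have "(1 - z) * z * deriv e z = (z - 1) * e z + f z" using ode z by (simp add: cesaro_ode_def)
    then have "f z = (1 - z) * (e z + z * (\<i> / (1 + z) * e z))"
      by (simp add: DERIV_imp_deriv[OF de[OF z]] algebra_simps)
    then have "(1 + z) * f z = (1 - z) * ((1 + z) + z * \<i>) * e z"
      using z1 by (simp add: field_simps)
    then have "norm (1 + z) * norm (f z) = norm (1 - z) * norm ((1 + z) + z * \<i>) * norm (e z)"
      by (metis norm_mult)
    moreover have "norm (e z) = 1"
    proof -
      have "Ln (1 + z) = of_real (ln (1 - x))" using elim Ln_of_real[of "1 - x"] by (simp add: z_def)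
      then show ?thesis by (simp add: e_def norm_exp_eq_Re)
    qed
    moreover have "norm (1 + z) = 1 - x"
      using elim norm_of_real[of "1 - x", where 'a = complex] by (simp add: z_def)
    moreover have "1 \<le> norm (1 - z)"
      using elim norm_of_real[of "1 + x", where 'a = complex] by (simp add: z_def)
    \<comment> \<open>The imaginary part is \<open>- x\<close>, since z is real.\<close>
    moreover have "x \<le> norm ((1 + z) + z * \<i>)"
      using abs_Im_le_cmod[of "(1 + z) + z * \<i>"] elim by (simp add: z_def)
    ultimately have "x \<le> (1 - x) * norm (f z)"
      using mult_mono[of 1 "norm (1 - z)" x "norm ((1 + z) + z * \<i>)"] elim by simp
    then show ?case using elim by (simp add: z_def)
  qed
  ultimately have "(1::real) \<le> 0"
    by (intro tendsto_le[OF trivial_limit_at_left_real _ tendsto_ident_at])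
  then show False by simp
qed

subsection \<open>The resolvent set\<close>

text \<open>With \<open>h = cesaro f\<close>, the resolvent equation is solved for \<open>f\<close>
  as \<open>(h + g) / l\<close>. The constant \<open>M\<close> depends only on \<open>l\<close>,
  which is what continuity of the inverse requires.\<close>

lemma resolvent_solution_bound:
  assumes l: "l \<noteq> 0" "Re l \<le> 0" and g: "g \<in> Hv k"
  defines "M \<equiv> norm (1 / l) * (2 * exp (2 * norm (1 / l) + 2 * pi * norm (1 / l)) * norm (1 / l) + 1)"
  obtains f where "f \<in> Hv (Suc k)" "(\<lambda>z. l * f z - cesaro f z) = g" "normv (Suc k) f \<le> M * normv k g"
proof -
  define \<mu> where "\<mu> = 1 / l"
  define K where "K = exp (2 * norm \<mu> + 2 * pi * norm \<mu>)"
  have \<mu>: "Re \<mu> \<le> 0" using l by (simp add: \<mu>_def Re_divide divide_nonpos_nonneg)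
  have gHD: "g \<in> HD" using g by (simp add: Hv_def)
  then have "(\<lambda>z. \<mu> * g z) holomorphic_on Disc" by (auto simp: HD_def intro!: holomorphic_intros)
  then obtain h where h: "cesaro_ode \<mu> (\<lambda>z. \<mu> * g z) h" using cesaro_ode_solution_exists \<mu> by blast
  have "norm (\<mu> * g w) \<le> (norm \<mu> * normv k g) * log_growth w ^ k" if "w \<in> Disc" for w
    using norm_le_normv[OF g that] by (simp add: norm_mult mult_left_mono mult.assoc)
  from cesaro_ode_bound[OF h \<mu> _ this]
  have hb: "norm (h z) \<le> 2 * K * (norm \<mu> * normv k g) * log_growth z ^ Suc k" if "z \<in> Disc" for z
    using that normv_nonneg[OF g] by (simp add: K_def)
  define f where "f z = (if z \<in> Disc then \<mu> * h z + \<mu> * g z else 0)" for z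
  have "cesaro_ode 0 f h" using h cesaro_ode_shift[of f \<mu> h "\<lambda>z. \<mu> * g z"] by (simp add: f_def)
  then have C: "cesaro f z = h z" if "z \<in> Disc" for z using that by (rule cesaro_eq_of_ode)
  have "h holomorphic_on Disc" using h by (simp add: cesaro_ode_def)
  then have fHD: "f \<in> HD"
    unfolding f_def using gHD by (intro HD_restrict holomorphic_intros) (auto simp: HD_def)
  have fb: "norm (f z) \<le> (M * normv k g) * log_growth z ^ Suc k" if z: "z \<in> Disc" for z
  proof -
    have "norm (g z) \<le> normv k g * log_growth z ^ k" by (rule norm_le_normv[OF g z])
    also have "\<dots> \<le> normv k g * log_growth z ^ Suc k"
      using log_growth_ge_1 normv_nonneg[OF g] by (intro mult_left_mono power_increasing) auto
    finally have "norm (g z) \<le> normv k g * log_growth z ^ Suc k" .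
    then have "norm (h z + g z) \<le> 2 * K * (norm \<mu> * normv k g) * log_growth z ^ Suc k + normv k g * log_growth z ^ Suc k"
      using hb[OF z] norm_triangle_ineq[of "h z" "g z"] by linarith
    then have "norm \<mu> * norm (h z + g z) \<le> norm \<mu> * (2 * K * (norm \<mu> * normv k g) * log_growth z ^ Suc k + normv k g * log_growth z ^ Suc k)"
      by (intro mult_left_mono) auto
    moreover have "norm (f z) = norm \<mu> * norm (h z + g z)"
      using z by (simp add: f_def norm_mult flip: distrib_left)
    ultimately show ?thesis by (simp add: M_def K_def \<mu>_def[symmetric] algebra_simps)
  qed
  show thesis
  proof
    show "f \<in> Hv (Suc k)" using fHD fb unfolding Hv_iff by blast
    show "normv (Suc k) f \<le> M * normv k g" by (rule normv_le[OF fb])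
    show "(\<lambda>z. l * f z - cesaro f z) = g"
    proof
      fix z show "l * f z - cesaro f z = g z"
      proof (cases "z \<in> Disc")
        case True
        then show ?thesis using C l by (simp add: f_def \<mu>_def field_simps)
      next
        case False
        then show ?thesis using gHD by (simp add: f_def cesaro_def HD_def)
      qed
    qed
  qed
qed

lemma resolvent_set_contains:
  assumes l: "l \<noteq> 0" "Re l \<le> 0"
  shows "l \<in> VH_resolvent cesaro"
proof -
  define A where "A = (\<lambda>f z. l * f z - cesaro f z)"
  have inj: "inj_on A VH" unfolding A_def by (rule inj_on_resolvent_operator)
  have lin: "A (\<lambda>z. a * f z + b * g z) = (\<lambda>z. a * A f z + b * A g z)" if "f \<in> VH" "g \<in> VH" for f g a b
    unfolding A_def using cesaro_lincomb[OF that[THEN VH_imp_HD]] by (simp add: algebra_simps)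
  have AVH: "A f \<in> VH" if "f \<in> VH" for f
    using VH_lincomb[OF that cesaro_VH[OF that], of l "-1"] by (simp add: A_def)
  have "g \<in> A ` VH" if gVH: "g \<in> VH" for g
  proof -
    obtain k where "g \<in> Hv k" using gVH by (auto simp: VH_def)
    from resolvent_solution_bound[OF l this] obtain f where "f \<in> Hv (Suc k)" "A f = g"
      unfolding A_def by blast
    then show ?thesis by (force simp: VH_def)
  qed
  then have bij: "bij_betw A VH VH" using inj AVH by (auto simp: bij_betw_def)
  then have surj: "A ` VH = VH" by (simp add: bij_betw_def)
  have inv: "inv_into VH A g \<in> VH" "A (inv_into VH A g) = g" if "g \<in> VH" for g
    using that surj by (metis inv_into_into, metis f_inv_into_f)
  \<comment> \<open>The inverse maps step \<open>k\<close> boundedly into step \<open>k + 1\<close>;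
    injectivity identifies it with the solution constructed above.\<close>
  have "continuous_map VH_top VH_top (inv_into VH A)"
  proof (rule continuous_map_VH_top)
    show "inv_into VH A f \<in> VH" if "f \<in> VH" for f using inv that by blast
    show "inv_into VH A (\<lambda>z. a * f z + b * g z) = (\<lambda>z. a * inv_into VH A f z + b * inv_into VH A g z)"
      if "f \<in> VH" "g \<in> VH" for f g a b
      using that by (intro inv_into_f_eq[OF inj]) (auto simp: lin inv intro: VH_lincomb)
    fix k :: nat assume k: "1 \<le> k"
    define M where "M = norm (1 / l) * (2 * exp (2 * norm (1 / l) + 2 * pi * norm (1 / l)) * norm (1 / l) + 1)"
    have "inv_into VH A g \<in> Hv (Suc k) \<and> normv (Suc k) (inv_into VH A g) \<le> M * normv k g" if g: "g \<in> Hv k" for g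
    proof -
      obtain f where f: "f \<in> Hv (Suc k)" "A f = g" "normv (Suc k) f \<le> M * normv k g"
        using resolvent_solution_bound[OF l g] unfolding A_def M_def by blast
      then have "inv_into VH A g = f" by (intro inv_into_f_eq[OF inj]) (auto simp: VH_def)
      then show ?thesis using f by simp
    qed
    then show "\<exists>m M. 1 \<le> m \<and> (\<forall>f\<in>Hv k. inv_into VH A f \<in> Hv m \<and> normv m (inv_into VH A f) \<le> M * normv k f)"
      by (intro exI[of _ "Suc k"] exI[of _ M]) auto
  qed
  with bij show ?thesis by (simp add: VH_resolvent_def A_def)
qed

theorem theorem2p4:
  shows "VH_point_spectrum cesaro = {} \<and> VH_spectrum cesaro = {0} \<union> {l. 0 < Re l}"
proof
  show "VH_point_spectrum cesaro = {}"
    using inj_on_resolvent_operator by (simp add: VH_point_spectrum_def)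
  have res: "l \<in> VH_resolvent cesaro \<longleftrightarrow> l \<noteq> 0 \<and> Re l \<le> 0" for l
  proof
    assume "l \<in> VH_resolvent cesaro"
    then have "(\<lambda>f z. l * f z - cesaro f z) ` VH = VH"
      by (simp add: VH_resolvent_def Let_def bij_betw_def)
    then show "l \<noteq> 0 \<and> Re l \<le> 0"
      using not_surj_cesaro not_surj_resolvent_operator_pos[of l] by (metis linorder_not_le)
  qed (use resolvent_set_contains in blast)
  show "VH_spectrum cesaro = {0} \<union> {l. 0 < Re l}"
    unfolding VH_spectrum_def set_eq_iff Compl_iff res by auto
qed

end
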